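(* Let $\varphi:[0,\infty)\to[0,\infty)$ be a gauge function (increasing, continuous, $\varphi(0)=0$). If there exists a constant $c>0$ such that $$\lim_{r\to0}\frac{rH(r)}{\varphi(r)}=0,\qquad\text{where } H(r)=\exp\left(c\left(\frac{\log(1/r)}{\log\log(1/r)}\right)^{1/4}\right),$$ then there exists a compact set of uniqueness $K\subset[0,1]$ such that $\mathcal H^\varphi(K)>0$ and $$\mathcal H^{\varphi}(K\cap\mathbb A)>0 .$$
   Context: For a gauge function $\varphi$, the Hausdorff measure is $\mathcal H^\varphi(E)=\lim_{\delta\to0}\mathcal H^\varphi_\delta(E)$ with $\mathcal H^\varphi_\delta(E)=\inf\{\sum_{i}\varphi(|U_i|): E\subset\bigcup_{i=1}^\infty U_i,\ |U_i|\le\delta\}$, where $|U|$ is the diameter of $U$. A set $E\subset[0,1]$ is a set of uniqueness if $\sum_{n=0}^\infty (a_n\cos(2\pi nx)+b_n\sin(2\pi nx))=0$ for all $x\in[0,1]\setminus E$ implies that $a_n=b_n=0$ for each $n$ (where for $n=0$ only $a_0$ is relevant). A real number $x$ is $b$-normal if the sequence of fractional parts $\{b^kx\}_{k\ge1}$ is equidistributed in $[0,1]$ with respect to Lebesgue measure; $x$ is absolutely normal if it is $b$-normal for every integer $b\ge2$. $\mathbb A$ denotes the (Borel) set of absolutely normal real numbers. *)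

theory Defs
  imports "HOL-Analysis.Analysis"
begin

definition gauge_function :: "(real \<Rightarrow> real) \<Rightarrow> bool" where
  "gauge_function \<phi> \<longleftrightarrow>
     \<phi> ` {0..} \<subseteq> {0..} \<and> mono_on {0..} \<phi> \<and> continuous_on {0..} \<phi> \<and> \<phi> 0 = 0"

text \<open>
  Boundedness of the covering sets is part of the condition \<open>|U| \<le> \<delta>\<close>: the library's real-valued
  \<^const>\<open>diameter\<close> is unspecified on unbounded sets.
\<close>

definition hausdorff_premeasure ::
    "(real \<Rightarrow> real) \<Rightarrow> real \<Rightarrow> 'a::metric_space set \<Rightarrow> ennreal" where
  "hausdorff_premeasure \<phi> \<delta> E =
     (INF U \<in> {U :: nat \<Rightarrow> 'a set. E \<subseteq> (\<Union>i. U i) \<and> (\<forall>i. bounded (U i) \<and> diameter (U i) \<le> \<delta>)}.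
        \<Sum>i. ennreal (\<phi> (diameter (U i))))"

definition hausdorff_measure :: "(real \<Rightarrow> real) \<Rightarrow> 'a::metric_space set \<Rightarrow> ennreal" where
  "hausdorff_measure \<phi> E = Lim (at_right 0) (\<lambda>\<delta>. hausdorff_premeasure \<phi> \<delta> E)"

lemma hausdorff_premeasure_antimono:
  assumes "\<delta> \<le> \<epsilon>"
  shows "hausdorff_premeasure \<phi> \<epsilon> E \<le> hausdorff_premeasure \<phi> \<delta> E"
  unfolding hausdorff_premeasure_def
  by (rule INF_superset_mono) (use assms order_trans in blast)+

text \<open>The limit defining the Hausdorff measure always exists, so \<^const>\<open>Lim\<close> is meaningful.\<close>

lemma hausdorff_premeasure_tendsto_SUP:
  "((\<lambda>\<delta>. hausdorff_premeasure \<phi> \<delta> E) \<longlongrightarrow> (SUP \<delta>\<in>{0<..}. hausdorff_premeasure \<phi> \<delta> E)) (at_right 0)"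
proof (rule order_tendstoI)
  fix a assume "a < (SUP \<delta>\<in>{0<..}. hausdorff_premeasure \<phi> \<delta> E)"
  then obtain \<epsilon> where "\<epsilon> > 0" "a < hausdorff_premeasure \<phi> \<epsilon> E"
    by (auto simp: less_SUP_iff)
  then have "a < hausdorff_premeasure \<phi> \<delta> E" if "0 < \<delta>" "\<delta> < \<epsilon>" for \<delta>
    using hausdorff_premeasure_antimono[of \<delta> \<epsilon> \<phi> E] that by auto
  then show "\<forall>\<^sub>F \<delta> in at_right 0. a < hausdorff_premeasure \<phi> \<delta> E"
    unfolding eventually_at_right_field using \<open>\<epsilon> > 0\<close> by blast
next
  fix a assume "(SUP \<delta>\<in>{0<..}. hausdorff_premeasure \<phi> \<delta> E) < a"
  then have "hausdorff_premeasure \<phi> \<delta> E < a" if "0 < \<delta>" for \<delta>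
    by (meson SUP_upper greaterThan_iff le_less_trans that)
  then show "\<forall>\<^sub>F \<delta> in at_right 0. hausdorff_premeasure \<phi> \<delta> E < a"
    unfolding eventually_at_right_field using zero_less_one by blast
qed

lemma hausdorff_measure_eq_SUP:
  "hausdorff_measure \<phi> E = (SUP \<delta>\<in>{0<..}. hausdorff_premeasure \<phi> \<delta> E)"
  unfolding hausdorff_measure_def
  by (rule tendsto_Lim[OF _ hausdorff_premeasure_tendsto_SUP]) simp

definition set_of_uniqueness :: "real set \<Rightarrow> bool" where
  "set_of_uniqueness E \<longleftrightarrow> E \<subseteq> {0..1} \<and>
     (\<forall>a b :: nat \<Rightarrow> real.
        (\<forall>x \<in> {0..1} - E.
           (\<lambda>n. a n * cos (2 * pi * real n * x) + b n * sin (2 * pi * real n * x)) sums 0) \<longrightarrow>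
        (\<forall>n. a n = 0) \<and> (\<forall>n\<ge>1. b n = 0))"

text \<open>The sequence is indexed from \<open>1\<close>; the value \<open>y 0\<close> is ignored.\<close>

definition equidistributed_unit_interval :: "(nat \<Rightarrow> real) \<Rightarrow> bool" where
  "equidistributed_unit_interval y \<longleftrightarrow>
     (\<forall>\<alpha> \<beta>. 0 \<le> \<alpha> \<and> \<alpha> < \<beta> \<and> \<beta> \<le> 1 \<longrightarrow>
        (\<lambda>N. real (card {k \<in> {1..N}. y k \<in> {\<alpha>..<\<beta>}}) / real N) \<longlonglongrightarrow> measure lborel {\<alpha>..<\<beta>})"

definition normal_in_base :: "nat \<Rightarrow> real \<Rightarrow> bool" where
  "normal_in_base b x \<longleftrightarrow> equidistributed_unit_interval (\<lambda>k. frac (real b ^ k * x))"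

definition absolutely_normal :: "real set" where
  "absolutely_normal = {x. \<forall>b\<ge>2. normal_in_base b x}"

end

(* Only phi(r)/r -> infinity is used, since the growth factor is at least 1. For an infinite, very
   sparse set S of digit positions, K consists of the x in [0,1] whose binary digits at the positions
   in S vanish (up to endpoints): for n = 2^s, s in S, the multiple n x avoids the arc (1/2,1) mod 1,
   so K is an H-set.

   Uniqueness is Rajchman's theorem. If a trigonometric series converges to 0 off K, its coefficients
   tend to 0 (Cantor-Lebesgue), and the twice integrated series is affine on each gap
   ((j+1/2)/n, (j+1)/n) (Riemann, Schwarz). The vanishing second differences at the n midpoints,
   averaged against the l-th character, keep only the frequencies congruent to l or -l mod n. All of
   these except l itself are large as n grows, so the l-th coefficient is 0.

   Erasing the digits in S from a uniformly random point gives a measure mu on K under which an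
   interval of length about 2^-n has mass at most 2 * 2^k(n) / 2^n, k(n) being the number of erased
   positions below n. If k grows slowly enough, this is dominated by phi, and mu is so close to
   Lebesgue measure that the second moment bound for digit frequencies in any base, Chebyshev's
   inequality and Borel-Cantelli give absolute normality mu-almost everywhere. The mass distribution
   principle concludes. *)

theory Submission
  imports Defs "HOL-Probability.Probability"
begin

section \<open>Riemann summation\<close>

text \<open>Two losses have to be paid for. In the uniqueness part the far resonant coefficients are
  only known to tend to 0. What makes their total contribution small is the kernel
  \<open>sinc_sq\<close>: it decays quadratically in the block number, so the remainder is at most a
  fixed multiple of the largest far coefficient, uniformly in n. The second moment is therefore
  computed for the counting measure on strings of L digits, where independence is exact, and
  transferred by bounding the mass of each base b cell by its length times sqrt(L + 1), up to a
  constant. This is why S obeys 4^k(n) <= n + 1, that is 2^k(n) <= sqrt(n + 1): along N = M^4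
  Chebyshev's 1 / N times the loss sqrt(N) is of order M^(-2), hence summable, while consecutive
  fourth powers still have ratio tending to 1. The gauge adds a second lower bound on the elements
  of S.\<close>

definition sinc_sq :: "real \<Rightarrow> real" where
  "sinc_sq t = (sinc t)\<^sup>2"

lemma sinc_sq_0 [simp]: "sinc_sq 0 = 1"
  by (simp add: sinc_sq_def)

lemma sinc_sq_nonneg: "0 \<le> sinc_sq t"
  by (simp add: sinc_sq_def)

lemma sinc_sq_le_1: "sinc_sq t \<le> 1"
proof -
  have "\<bar>sinc t\<bar> \<le> 1"
    using abs_sin_x_le_abs_x[of t] by (auto simp: field_simps)
  then show ?thesis
    unfolding sinc_sq_def by (simp add: abs_square_le_1)
qed

lemma sinc_sq_le_inverse_square: "sinc_sq t \<le> 1 / t\<^sup>2" if "t \<noteq> 0"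
proof -
  have "(sin t)\<^sup>2 \<le> 1"
    by (simp add: abs_square_le_1)
  then show ?thesis
    using that by (simp add: sinc_sq_def power_divide divide_right_mono)
qed

lemma isCont_sinc_sq: "isCont sinc_sq x"
  unfolding sinc_sq_def [abs_def] by (intro isCont_power isCont_sinc)

lemma has_real_derivative_sinc_sq:
  assumes "t > 0"
  shows "(sinc_sq has_real_derivative 2 * (sin t / t) * ((t * cos t - sin t) / t\<^sup>2)) (at t)"
proof -
  have "((\<lambda>t. (sin t / t)\<^sup>2) has_real_derivative 2 * (sin t / t) * ((t * cos t - sin t) / t\<^sup>2)) (at t)"
    using assms by (auto intro!: derivative_eq_intros simp: power2_eq_square field_simps)
  then show ?thesis
  proof (rule DERIV_cong_ev[THEN iffD1, rotated -1])
    have "\<forall>\<^sub>F x in nhds t. x > 0"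
      using assms order_tendstoD(1)[OF filterlim_ident] by blast
    then show "\<forall>\<^sub>F x in nhds t. (sin x / x)\<^sup>2 = sinc_sq x"
      by eventually_elim (simp add: sinc_sq_def)
  qed auto
qed

text \<open>\<open>t * cos t - sin t\<close> is the numerator in the derivative of
  \<open>sin t / t\<close>. Its own derivative \<open>- t * sin t\<close> has modulus at most t,
  which gives the quadratic bound that cancels the squared denominator near 0.\<close>

lemma abs_x_cos_x_minus_sin_x_le:
  fixes t :: real
  assumes "t \<ge> 0"
  shows "\<bar>t * cos t - sin t\<bar> \<le> t\<^sup>2 / 2"
proof -
  have *: "s * (0 * cos 0 - sin 0) - 0\<^sup>2 / 2 \<ge> s * (t * cos t - sin t) - t\<^sup>2 / 2" if s: "\<bar>s\<bar> = 1" for s :: real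
  proof (rule DERIV_nonpos_imp_nonincreasing[OF assms])
    fix x :: real assume x: "0 \<le> x" "x \<le> t"
    have "((\<lambda>x. s * (x * cos x - sin x) - x\<^sup>2 / 2) has_real_derivative (- (s * x * sin x) - x)) (at x)"
      by (auto intro!: derivative_eq_intros simp: algebra_simps)
    moreover have "\<bar>s * x * sin x\<bar> \<le> x"
      using x s abs_sin_le_one[of x] by (simp add: abs_mult mult_left_le)
    then have "- (s * x * sin x) - x \<le> 0"
      by linarith
    ultimately show "\<exists>y. ((\<lambda>x. s * (x * cos x - sin x) - x\<^sup>2 / 2) has_real_derivative y) (at x) \<and> y \<le> 0"
      by blast
  qed
  show ?thesis
    unfolding abs_le_iff using *[of 1] *[of "-1"] by simp
qed

text \<open>The majorant is the derivative of \<open>8 * arctan t\<close>, which lets the variation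
  be bounded by monotonicity alone. Up to 1 the quadratic bound on the numerator is used; beyond 1
  crude bounds give \<open>4 / t\<^sup>2\<close>, and this fixes the constant 8.\<close>

lemma abs_deriv_sinc_sq_le:
  fixes t :: real
  assumes "t > 0"
  shows "\<bar>2 * (sin t / t) * ((t * cos t - sin t) / t\<^sup>2)\<bar> \<le> 8 / (1 + t\<^sup>2)"
proof (cases "t \<le> 1")
  case True
  have "\<bar>sin t / t\<bar> \<le> 1"
    using abs_sin_x_le_abs_x[of t] assms by (auto simp: field_simps)
  moreover have "\<bar>(t * cos t - sin t) / t\<^sup>2\<bar> \<le> 1 / 2"
    using abs_x_cos_x_minus_sin_x_le[of t] assms by (auto simp: field_simps)
  ultimately have "\<bar>sin t / t\<bar> * \<bar>(t * cos t - sin t) / t\<^sup>2\<bar> \<le> 1 * (1 / 2)"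
    by (intro mult_mono) auto
  moreover have "8 / (1 + t\<^sup>2) \<ge> 4"
    using True assms power_le_one[of t 2] by (simp add: pos_le_divide_eq add_pos_nonneg)
  ultimately show ?thesis
    by (simp only: abs_mult abs_numeral mult.assoc)
next
  case False
  have "\<bar>t * cos t - sin t\<bar> \<le> \<bar>t * cos t\<bar> + \<bar>sin t\<bar>"
    by linarith
  also have "\<bar>t * cos t\<bar> \<le> t"
    using assms abs_cos_le_one[of t] by (simp add: abs_mult mult_left_le)
  also have "\<bar>sin t\<bar> \<le> t"
    using abs_sin_le_one[of t] False by linarith
  finally have 1: "\<bar>t * cos t - sin t\<bar> / t\<^sup>2 \<le> (t + t) / t\<^sup>2"
    by (intro divide_right_mono) auto
  have 2: "\<bar>sin t\<bar> / t \<le> 1 / t"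
    using assms by (intro divide_right_mono) auto
  have "(\<bar>sin t\<bar> / t) * (\<bar>t * cos t - sin t\<bar> / t\<^sup>2) \<le> (1 / t) * ((t + t) / t\<^sup>2)"
    using 1 2 assms by (intro mult_mono) auto
  also have "\<dots> = 2 / t\<^sup>2"
    using assms by (simp add: field_simps power2_eq_square)
  finally have "\<bar>2 * (sin t / t) * ((t * cos t - sin t) / t\<^sup>2)\<bar> \<le> 4 / t\<^sup>2"
    using assms by (simp add: abs_mult)
  also have "\<dots> \<le> 8 / (1 + t\<^sup>2)"
    using False assms one_le_power[of t 2] divide_left_mono[of "1 + t\<^sup>2" "2 * t\<^sup>2" 8]
    by (simp add: add_pos_nonneg)
  finally show ?thesis .
qed

text \<open>Both the sum and the difference of \<open>8 * arctan\<close> and \<open>sinc_sq\<close>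
  are nondecreasing on the positive half line; \<sigma> is the sign.\<close>

lemma sinc_sq_variation:
  assumes "0 < s" "s \<le> t"
  shows "\<bar>sinc_sq t - sinc_sq s\<bar> \<le> 8 * (arctan t - arctan s)"
proof -
  have *: "8 * arctan s + \<sigma> * sinc_sq s \<le> 8 * arctan t + \<sigma> * sinc_sq t" if \<sigma>: "\<bar>\<sigma>\<bar> = 1" for \<sigma>
  proof (rule DERIV_nonneg_imp_nondecreasing[OF \<open>s \<le> t\<close>])
    fix x assume "s \<le> x" "x \<le> t"
    then have x: "x > 0" using assms by simp
    let ?D = "2 * (sin x / x) * ((x * cos x - sin x) / x\<^sup>2)"
    have "((\<lambda>x. 8 * arctan x + \<sigma> * sinc_sq x) has_real_derivative (8 * inverse (1 + x\<^sup>2) + \<sigma> * ?D)) (at x)"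
      using x by (intro derivative_intros DERIV_cmult DERIV_arctan has_real_derivative_sinc_sq)
    moreover have "\<bar>\<sigma> * ?D\<bar> \<le> 8 / (1 + x\<^sup>2)"
      using abs_deriv_sinc_sq_le[OF x] \<sigma> by (simp only: abs_mult mult_1)
    then have "0 \<le> 8 * inverse (1 + x\<^sup>2) + \<sigma> * ?D"
      unfolding divide_inverse by linarith
    ultimately show "\<exists>y. ((\<lambda>x. 8 * arctan x + \<sigma> * sinc_sq x) has_real_derivative y) (at x) \<and> 0 \<le> y"
      by blast
  qed
  show ?thesis
    using *[of 1] *[of "-1"] by simp
qed

text \<open>The arctan bounds telescope to at most 8 times pi / 2. The value depends neither on the
  step h nor on the range, which is the regularity that Riemann's method needs.\<close>

lemma sum_sinc_sq_variation:
  assumes "h > 0" "1 \<le> k" "k \<le> M"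
  shows "(\<Sum>m=k..<M. \<bar>sinc_sq (real m * h) - sinc_sq (real (Suc m) * h)\<bar>) \<le> 4 * pi"
proof -
  have "(\<Sum>m=k..<M. \<bar>sinc_sq (real m * h) - sinc_sq (real (Suc m) * h)\<bar>)
      \<le> (\<Sum>m=k..<M. 8 * arctan (real (Suc m) * h) - 8 * arctan (real m * h))"
  proof (rule sum_mono)
    fix m assume "m \<in> {k..<M}"
    then have "0 < real m * h" "real m * h \<le> real (Suc m) * h"
      using assms by auto
    from sinc_sq_variation[OF this]
    show "\<bar>sinc_sq (real m * h) - sinc_sq (real (Suc m) * h)\<bar>
        \<le> 8 * arctan (real (Suc m) * h) - 8 * arctan (real m * h)"
      by (subst abs_minus_commute) (simp only: right_diff_distrib)
  qed
  also have "\<dots> = 8 * arctan (real M * h) - 8 * arctan (real k * h)"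
    using sum_Suc_diff'[of k M "\<lambda>m. 8 * arctan (real m * h)"] assms by simp
  also have "\<dots> \<le> 4 * pi"
    using arctan_ubound[of "real M * h"] zero_le_arctan_iff[of "real k * h"] assms
      mult_nonneg_nonneg[of "real k" h] by linarith
  finally show ?thesis .
qed

lemma sum_by_parts:
  fixes A w :: "nat \<Rightarrow> real"
  shows "(\<Sum>m<M. A m * w m) = (\<Sum>i<M. A i) * w M + (\<Sum>m<M. (\<Sum>i<Suc m. A i) * (w m - w (Suc m)))"
  by (induction M) (simp_all add: algebra_simps)

text \<open>Regularity of Riemann's summation method: the weights have bounded total variation, uniformly in the step.\<close>

lemma riemann_summation_bound:
  fixes A :: "nat \<Rightarrow> real"
  assumes A: "A sums 0" and \<epsilon>: "\<epsilon> > 0"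
  shows "\<forall>\<^sub>F h in at_right 0. \<forall>\<^sub>F M in sequentially. \<bar>\<Sum>m<M. A m * sinc_sq (real m * h)\<bar> \<le> \<epsilon>"
proof -
  define S where "S M = (\<Sum>i<M. A i)" for M
  have S: "S \<longlonglongrightarrow> 0"
    using A unfolding S_def sums_def .
  then obtain B where B: "\<And>M. \<bar>S M\<bar> \<le> B"
    using convergent_imp_Bseq[of S] unfolding convergent_def Bseq_def by auto
  have "B \<ge> 0" using B[of 0] by linarith
  \<comment> \<open>Three errors are added: \<delta> for the boundary term of the summation by
    parts, \<delta> for the first k terms, and 4 pi \<delta> for the rest.\<close>
  define \<delta> where "\<delta> = \<epsilon> / (2 + 4 * pi)"
  have \<delta>: "\<delta> > 0" "\<delta> * (2 + 4 * pi) = \<epsilon>"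
    using \<epsilon> add_pos_pos[of 2 "4 * pi"] by (auto simp: \<delta>_def simp del: add_2_eq_Suc)
  obtain N0 where N0: "\<And>M. M \<ge> N0 \<Longrightarrow> \<bar>S M\<bar> < \<delta>"
    using S \<delta>(1) unfolding LIMSEQ_iff by auto
  define k where "k = Suc N0"
  \<comment> \<open>The first k weight differences are finitely many continuous functions of h that
    vanish at h = 0.\<close>
  define V where "V h = B * (\<Sum>m<k. \<bar>sinc_sq (real m * h) - sinc_sq (real (Suc m) * h)\<bar>)" for h
  have "isCont V 0"
    unfolding V_def by (intro continuous_intros isCont_o2[OF _ isCont_sinc_sq])
  then have "(V \<longlongrightarrow> V 0) (at_right 0)"
    unfolding isCont_def by (rule filterlim_mono) (auto simp: at_within_le_at)
  then have "(V \<longlongrightarrow> 0) (at_right 0)"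
    by (simp add: V_def)
  then have "\<forall>\<^sub>F h in at_right 0. V h < \<delta>"
    using \<delta>(1) by (rule order_tendstoD)
  moreover have "\<forall>\<^sub>F h in at_right 0. h > (0::real)"
    by (simp add: eventually_at_right_less)
  ultimately show ?thesis
  proof eventually_elim
    fix h :: real assume h: "V h < \<delta>" "h > 0"
    define d where "d m = sinc_sq (real m * h) - sinc_sq (real (Suc m) * h)" for m
    have "\<bar>\<Sum>m<M. A m * sinc_sq (real m * h)\<bar> \<le> \<epsilon>" if M: "M \<ge> k" for M
    proof -
      have "(\<Sum>m<M. A m * sinc_sq (real m * h)) = S M * sinc_sq (real M * h) + (\<Sum>m<M. S (Suc m) * d m)"
        unfolding S_def d_def by (rule sum_by_parts)
      moreover have "\<bar>S M * sinc_sq (real M * h)\<bar> \<le> \<delta> * 1"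
        unfolding abs_mult using N0[of M] M sinc_sq_nonneg sinc_sq_le_1 \<delta>
        by (intro mult_mono) (auto simp: k_def abs_of_nonneg)
      moreover have "\<bar>\<Sum>m<M. S (Suc m) * d m\<bar> \<le> (\<Sum>m<M. \<bar>S (Suc m) * d m\<bar>)"
        by (rule sum_abs)
      moreover have "(\<Sum>m<M. \<bar>S (Suc m) * d m\<bar>) = (\<Sum>m<k. \<bar>S (Suc m) * d m\<bar>) + (\<Sum>m=k..<M. \<bar>S (Suc m) * d m\<bar>)"
        using sum.atLeastLessThan_concat[of 0 k M "\<lambda>m. \<bar>S (Suc m) * d m\<bar>"] M by (simp add: atLeast0LessThan)
      moreover have "(\<Sum>m<k. \<bar>S (Suc m) * d m\<bar>) \<le> V h"
        unfolding V_def d_def[symmetric] sum_distrib_left abs_mult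
        using B by (intro sum_mono mult_right_mono) auto
      moreover have "(\<Sum>m=k..<M. \<bar>S (Suc m) * d m\<bar>) \<le> \<delta> * (\<Sum>m=k..<M. \<bar>d m\<bar>)"
        unfolding sum_distrib_left abs_mult
        using N0 by (intro sum_mono mult_right_mono) (auto simp: k_def intro!: less_imp_le)
      moreover have "\<delta> * (\<Sum>m=k..<M. \<bar>d m\<bar>) \<le> \<delta> * (4 * pi)"
        unfolding d_def using sum_sinc_sq_variation[of h k M] h M \<delta>(1)
        by (intro mult_left_mono) (auto simp: k_def)
      moreover have "\<epsilon> = 2 * \<delta> + \<delta> * (4 * pi)"
        using \<delta>(2) by (simp add: algebra_simps)
      ultimately show ?thesis
        using h(1) by linarith
    qed
    then show "\<forall>\<^sub>F M in sequentially. \<bar>\<Sum>m<M. A m * sinc_sq (real m * h)\<bar> \<le> \<epsilon>"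
      unfolding eventually_sequentially by blast
  qed
qed

section \<open>Schwarz's theorem on vanishing symmetric second derivatives\<close>

lemma symmetric_derivative_zero_imp_nonpos:
  fixes G :: "real \<Rightarrow> real"
  assumes cont: "continuous_on {a..b} G" and "a \<le> b" and G: "G a \<le> 0" "G b \<le> 0"
    and der: "\<And>x. a < x \<Longrightarrow> x < b \<Longrightarrow> ((\<lambda>h. (G (x + h) + G (x - h) - 2 * G x) / h\<^sup>2) \<longlongrightarrow> 0) (at_right 0)"
    and x: "a \<le> x" "x \<le> b"
  shows "G x \<le> 0"
proof (rule ccontr)
  assume "\<not> G x \<le> 0"
  \<comment> \<open>Small enough that the correction in \<open>P\<close> stays below
    \<open>G x\<close> at the point x.\<close>
  define \<epsilon> where "\<epsilon> = G x / (1 + (b - a)\<^sup>2)"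
  have den: "1 + (b - a)\<^sup>2 > 0"
    by (simp add: add_pos_nonneg)
  have \<epsilon>: "\<epsilon> > 0"
    using \<open>\<not> G x \<le> 0\<close> den by (auto simp: \<epsilon>_def)
  \<comment> \<open>A strictly convex quadratic vanishing at both ends is added. It contributes
    exactly 2 \<epsilon> to the symmetric second derivative, whereas at an interior maximum of
    \<open>P\<close> the second differences are at most 0.\<close>
  define P where "P y = G y + \<epsilon> * ((y - a) * (y - b))" for y
  have "continuous_on {a..b} P"
    unfolding P_def by (intro continuous_intros cont)
  then obtain y where y: "y \<in> {a..b}" and max: "\<And>z. z \<in> {a..b} \<Longrightarrow> P z \<le> P y"
    using continuous_attains_sup[of "{a..b}" P] \<open>a \<le> b\<close> by auto
  have "(x - a) * (b - x) \<le> (b - a) * (b - a)"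
    using x by (intro mult_mono) auto
  then have "\<epsilon> * ((x - a) * (b - x)) \<le> \<epsilon> * (b - a)\<^sup>2"
    using \<epsilon> by (simp add: power2_eq_square)
  also have "\<dots> < \<epsilon> * (1 + (b - a)\<^sup>2)"
    using \<epsilon> by simp
  also have "\<dots> = G x"
    using den by (simp add: \<epsilon>_def)
  finally have "P x > 0"
    by (simp add: P_def algebra_simps)
  then have Py: "P y > 0"
    using max[of x] x by auto
  have ab: "a < y" "y < b"
    using Py y G by (auto simp: P_def less_le)
  have "((\<lambda>h. (G (y + h) + G (y - h) - 2 * G y) / h\<^sup>2 + 2 * \<epsilon>) \<longlongrightarrow> 0 + 2 * \<epsilon>) (at_right 0)"
    by (intro tendsto_intros der ab)
  then have "\<forall>\<^sub>F h in at_right 0. (G (y + h) + G (y - h) - 2 * G y) / h\<^sup>2 + 2 * \<epsilon> > 0"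
    by (rule order_tendstoD) (use \<epsilon> in simp)
  moreover have "\<forall>\<^sub>F h in at_right 0. h < min (y - a) (b - y)"
    using ab by (intro eventually_at_rightI[of _ "min (y - a) (b - y)"]) auto
  moreover have "\<forall>\<^sub>F h in at_right 0. h > (0::real)"
    by (simp add: eventually_at_right_less)
  ultimately have "\<forall>\<^sub>F h in at_right (0::real). False"
  proof eventually_elim
    fix h :: real
    assume h: "(G (y + h) + G (y - h) - 2 * G y) / h\<^sup>2 + 2 * \<epsilon> > 0" "h < min (y - a) (b - y)" "h > 0"
    have "P (y + h) + P (y - h) - 2 * P y = G (y + h) + G (y - h) - 2 * G y + 2 * \<epsilon> * h\<^sup>2"
      by (simp add: P_def power2_eq_square algebra_simps)
    also have "\<dots> = ((G (y + h) + G (y - h) - 2 * G y) / h\<^sup>2 + 2 * \<epsilon>) * h\<^sup>2"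
      using h by (simp add: field_simps)
    also have "\<dots> > 0"
      using h by simp
    finally show False
      using max[of "y + h"] max[of "y - h"] h by auto
  qed
  then show False
    by (simp add: trivial_limit_at_right_real)
qed

text \<open>Subtracting the chord makes the end values 0 and leaves second differences unchanged, so
  the maximum principle applies to both signs of \<open>F - L\<close> and F is affine. The midpoint
  identity is the form needed later: a vanishing second difference with the half length as
  step.\<close>

lemma symmetric_derivative_zero_imp_midpoint:
  fixes F :: "real \<Rightarrow> real"
  assumes cont: "continuous_on {a..b} F" and "a < b"
    and der: "\<And>x. a < x \<Longrightarrow> x < b \<Longrightarrow> ((\<lambda>h. (F (x + h) + F (x - h) - 2 * F x) / h\<^sup>2) \<longlongrightarrow> 0) (at_right 0)"
  shows "F a + F b = 2 * F ((a + b) / 2)"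
proof -
  define c where "c = (F b - F a) / (b - a)"
  define L where "L x = F a + c * (x - a)" for x
  have L: "L a = F a" "L b = F b" "2 * L ((a + b) / 2) = F a + F b"
    using \<open>a < b\<close> by (auto simp: L_def c_def divide_simps)
  have *: "s * (F x - L x) \<le> 0" if "a \<le> x" "x \<le> b" for s x
  proof (rule symmetric_derivative_zero_imp_nonpos[where G = "\<lambda>x. s * (F x - L x)", OF _ _ _ _ _ that])
    show "continuous_on {a..b} (\<lambda>x. s * (F x - L x))"
      unfolding L_def by (intro continuous_intros cont)
    fix x assume "a < x" "x < b"
    have "((\<lambda>h. s * ((F (x + h) + F (x - h) - 2 * F x) / h\<^sup>2)) \<longlongrightarrow> s * 0) (at_right 0)"
      by (intro tendsto_intros der) fact+
    moreover have "s * (F (x + h) - L (x + h)) + s * (F (x - h) - L (x - h)) - 2 * (s * (F x - L x))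
         = s * (F (x + h) + F (x - h) - 2 * F x)" for h
      by (simp add: L_def algebra_simps)
    ultimately show "((\<lambda>h. (s * (F (x + h) - L (x + h)) + s * (F (x - h) - L (x - h)) - 2 * (s * (F x - L x))) / h\<^sup>2) \<longlongrightarrow> 0) (at_right 0)"
      by simp
  qed (use \<open>a < b\<close> L in auto)
  have "F ((a + b) / 2) = L ((a + b) / 2)"
    using *[of "(a + b) / 2" 1] *[of "(a + b) / 2" "-1"] \<open>a < b\<close> by (simp add: field_simps)
  then show ?thesis
    using L by simp
qed

section \<open>Trigonometric series\<close>

definition trig_term :: "(nat \<Rightarrow> real) \<Rightarrow> (nat \<Rightarrow> real) \<Rightarrow> nat \<Rightarrow> real \<Rightarrow> real" where
  "trig_term a b m x = a m * cos (2 * pi * real m * x) + b m * sin (2 * pi * real m * x)"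

lemma continuous_on_trig_term: "continuous_on S (trig_term a b m)"
  unfolding trig_term_def by (intro continuous_intros)

lemma abs_trig_term_le: "\<bar>trig_term a b m x\<bar> \<le> \<bar>a m\<bar> + \<bar>b m\<bar>"
proof -
  have "\<bar>trig_term a b m x\<bar> \<le> \<bar>a m * cos (2 * pi * real m * x)\<bar> + \<bar>b m * sin (2 * pi * real m * x)\<bar>"
    unfolding trig_term_def by linarith
  also have "\<dots> \<le> \<bar>a m\<bar> + \<bar>b m\<bar>"
    unfolding abs_mult by (intro add_mono mult_left_le) auto
  finally show ?thesis .
qed

text \<open>A quarter period turns (cos, sin) into (- sin, cos), so the two values are the
  coordinates of the rotated vector with entries \<open>a m\<close> and \<open>b m\<close>.\<close>

lemma trig_term_quarter_period:
  assumes "m > 0"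
  shows "(trig_term a b m x)\<^sup>2 + (trig_term a b m (x + 1 / (4 * real m)))\<^sup>2 = (a m)\<^sup>2 + (b m)\<^sup>2"
proof -
  define \<theta> where "\<theta> = 2 * pi * real m * x"
  have "2 * pi * real m * (x + 1 / (4 * real m)) = \<theta> + pi / 2"
    using assms by (simp add: \<theta>_def field_simps)
  then have "(trig_term a b m x)\<^sup>2 + (trig_term a b m (x + 1 / (4 * real m)))\<^sup>2
      = (a m * cos \<theta> + b m * sin \<theta>)\<^sup>2 + (b m * cos \<theta> - a m * sin \<theta>)\<^sup>2"
    by (simp add: trig_term_def \<theta>_def[symmetric] cos_add sin_add)
  also have "\<dots> = ((a m)\<^sup>2 + (b m)\<^sup>2) * ((sin \<theta>)\<^sup>2 + (cos \<theta>)\<^sup>2)"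
    by (simp only: power2_eq_square) (simp only: algebra_simps)
  finally show ?thesis
    by simp
qed

text \<open>By Baire's theorem the terms are uniformly small on some interval; two points of it a quarter
  period apart then bound the amplitude.\<close>

lemma cantor_lebesgue:
  assumes "\<alpha> < \<beta>" and lim: "\<And>x. x \<in> {\<alpha>..\<beta>} \<Longrightarrow> (\<lambda>m. trig_term a b m x) \<longlonglongrightarrow> 0"
  shows "(\<lambda>m. (a m)\<^sup>2 + (b m)\<^sup>2) \<longlonglongrightarrow> 0"
proof (rule LIMSEQ_I)
  fix r :: real assume "r > 0"
  define \<epsilon> where "\<epsilon> = sqrt (r / 4)"
  have \<epsilon>: "\<epsilon> > 0" "\<epsilon>\<^sup>2 = r / 4"
    using \<open>r > 0\<close> by (auto simp: \<epsilon>_def)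
  define S where "S = {\<alpha>..\<beta>}"
  define C where "C N = {x \<in> S. \<forall>m\<ge>N. \<bar>trig_term a b m x\<bar> \<le> \<epsilon>}" for N
  have C_eq: "C N = S \<inter> (\<Inter>m\<in>{N..}. {x. \<bar>trig_term a b m x\<bar> \<le> \<epsilon>})" for N
    by (auto simp: C_def)
  have closedC: "closed (C N)" for N
    unfolding C_eq S_def
    by (intro closed_Int closed_INT ballI closed_Collect_le continuous_intros continuous_on_trig_term closed_atLeastAtMost)
  \<comment> \<open>Some \<open>C N\<close> has interior points relative to S: otherwise the
    relatively open sets \<open>S - C N\<close> would all be dense, although pointwise convergence
    makes their intersection empty.\<close>
  have "\<exists>N. \<not> S \<subseteq> closure (S - C N)"
  proof (rule ccontr)
    assume "\<not> ?thesis"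
    then have dense: "S \<subseteq> closure (S - C N)" for N by blast
    have "S \<subseteq> closure (\<Inter>(range (\<lambda>N. S - C N)))"
    proof (rule Baire)
      show "closed S" by (simp add: S_def)
      fix T assume "T \<in> range (\<lambda>N. S - C N)"
      then obtain N where T: "T = S - C N" by blast
      have "openin (top_of_set S) T"
        unfolding T using closedC[of N]
        by (metis Diff_eq open_Compl openin_open_Int)
      then show "openin (top_of_set S) T \<and> S \<subseteq> closure T"
        using dense T by blast
    qed simp
    moreover have "\<Inter>(range (\<lambda>N. S - C N)) = {}"
    proof -
      have "\<exists>N. x \<in> C N" if "x \<in> S" for x
      proof -
        have "\<forall>\<^sub>F m in sequentially. \<bar>trig_term a b m x\<bar> < \<epsilon>"
          using tendstoD[OF lim[of x] \<epsilon>(1)] that by (simp add: S_def)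
        then show ?thesis
          using that unfolding eventually_sequentially C_def by (force intro: less_imp_le)
      qed
      then show ?thesis by blast
    qed
    ultimately have "S = {}" by (simp only: closure_empty subset_empty)
    then show False using \<open>\<alpha> < \<beta>\<close> by (simp add: S_def)
  qed
  then obtain N x0 where x0: "x0 \<in> S" "x0 \<notin> closure (S - C N)" by blast
  then obtain e where e: "e > 0" "ball x0 e \<inter> (S - C N) = {}"
  proof -
    have "open (- closure (S - C N))" by auto
    then obtain e where "e > 0" "ball x0 e \<subseteq> - closure (S - C N)"
      using x0(2) by (meson Compl_iff openE)
    then show ?thesis
      using that closure_subset[of "S - C N"] by blast
  qed
  \<comment> \<open>Half the radius keeps the closed interval inside the open ball, and clipping
    keeps it inside S.\<close>
  define p where "p = max \<alpha> (x0 - e / 2)"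
  define q where "q = min \<beta> (x0 + e / 2)"
  have pq: "p < q" "{p..q} \<subseteq> C N"
  proof -
    show "p < q" using x0(1) \<open>e > 0\<close> \<open>\<alpha> < \<beta>\<close> by (auto simp: p_def q_def S_def)
    show "{p..q} \<subseteq> C N"
    proof
      fix y assume "y \<in> {p..q}"
      then have "y \<in> S" "y \<in> ball x0 e"
        using \<open>e > 0\<close> by (auto simp: p_def q_def S_def dist_real_def)
      then show "y \<in> C N" using e(2) by blast
    qed
  qed
  obtain N1 where N1: "1 / (q - p) < real N1"
    using reals_Archimedean2 by blast
  have "norm ((a m)\<^sup>2 + (b m)\<^sup>2 - 0) < r" if m: "m \<ge> max N N1" for m
  proof -
    have "0 < 1 / (q - p)" using pq by simp
    then have "m > 0" using N1 m by (cases m) auto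
    have "1 / (q - p) < real m"
      using N1 m by linarith
    then have "1 < 4 * real m * (q - p)"
      using pq \<open>m > 0\<close> by (simp add: field_simps)
    then have "1 / (4 * real m) \<le> q - p"
      using \<open>m > 0\<close> by (simp add: field_simps)
    then have "p \<in> C N" "p + 1 / (4 * real m) \<in> C N"
      using pq(1) by (auto intro!: subsetD[OF pq(2)])
    then have "\<bar>trig_term a b m p\<bar> \<le> \<epsilon>" "\<bar>trig_term a b m (p + 1 / (4 * real m))\<bar> \<le> \<epsilon>"
      using m by (auto simp: C_def)
    then have "(trig_term a b m p)\<^sup>2 \<le> \<epsilon>\<^sup>2" "(trig_term a b m (p + 1 / (4 * real m)))\<^sup>2 \<le> \<epsilon>\<^sup>2"
      by (simp_all add: abs_le_square_iff[symmetric])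
    then have "(a m)\<^sup>2 + (b m)\<^sup>2 \<le> r / 2"
      using trig_term_quarter_period[OF \<open>m > 0\<close>, of a b p] \<epsilon>(2) by linarith
    then show ?thesis using \<open>r > 0\<close> by simp
  qed
  then show "\<exists>no. \<forall>m\<ge>no. norm ((a m)\<^sup>2 + (b m)\<^sup>2 - 0) < r" by blast
qed

text \<open>Riemann's twice integrated series; for \<open>m = 0\<close> the quotient is \<open>0\<close> by convention.\<close>

definition riemann_function :: "(nat \<Rightarrow> real) \<Rightarrow> (nat \<Rightarrow> real) \<Rightarrow> real \<Rightarrow> real" where
  "riemann_function a b x = a 0 * x\<^sup>2 / 2 - (\<Sum>m. trig_term a b m x / (2 * pi * real m)\<^sup>2)"

context
  fixes a b :: "nat \<Rightarrow> real" and C :: real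
  assumes bounded: "\<And>m. \<bar>a m\<bar> + \<bar>b m\<bar> \<le> C"
begin

lemma trig_term_div_square_bound:
  "norm (trig_term a b m x / (2 * pi * real m)\<^sup>2) \<le> C * (1 / (real m)\<^sup>2)"
proof -
  have "1 * 1 \<le> (2 * pi) * (2 * pi)"
    using pi_ge_two by (intro mult_mono) auto
  then have "1 * (real m)\<^sup>2 \<le> (2 * pi)\<^sup>2 * (real m)\<^sup>2"
    by (intro mult_right_mono) (auto simp: power2_eq_square)
  then have le: "(real m)\<^sup>2 \<le> (2 * pi * real m)\<^sup>2"
    by (simp add: power_mult_distrib)
  have "\<bar>trig_term a b m x\<bar> / (2 * pi * real m)\<^sup>2 \<le> C / (real m)\<^sup>2"
  \<comment> \<open>For m = 0 both sides are 0 by the convention on division by 0.\<close>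
  proof (cases "m = 0")
    case False
    then show ?thesis
      using le bounded[of m] abs_trig_term_le[of a b m x] by (intro frac_le) auto
  qed simp
  then show ?thesis by simp
qed

lemma summable_riemann_bound: "summable (\<lambda>m. C * (1 / (real m)\<^sup>2))"
  using inverse_power_summable[of 2, where 'a = real] by (intro summable_mult) (simp add: field_simps)

lemma summable_trig_term_div_square: "summable (\<lambda>m. trig_term a b m x / (2 * pi * real m)\<^sup>2)"
  by (rule summable_comparison_test'[OF summable_riemann_bound trig_term_div_square_bound])

lemma continuous_on_riemann_function: "continuous_on S (riemann_function a b)"
proof -
  have "continuous_on S (\<lambda>x. \<Sum>m. trig_term a b m x / (2 * pi * real m)\<^sup>2)"
  proof (rule uniform_limit_theorem)
    show "uniform_limit S (\<lambda>n x. \<Sum>m<n. trig_term a b m x / (2 * pi * real m)\<^sup>2)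
        (\<lambda>x. \<Sum>m. trig_term a b m x / (2 * pi * real m)\<^sup>2) sequentially"
      by (rule Weierstrass_m_test[OF trig_term_div_square_bound summable_riemann_bound])
  qed (auto intro!: always_eventually continuous_on_sum continuous_on_mult_right continuous_on_trig_term
        simp: divide_inverse)
  then show ?thesis
    unfolding riemann_function_def by (intro continuous_intros) auto
qed

text \<open>The second difference with step h of the term of frequency m is that term times -4 times
  the square of sin (pi m h). Dividing by the integration factor and by the square of h yields the
  kernel, with the sign absorbed in the definition of the Riemann function. The quadratic part
  supplies the term m = 0, where the kernel is 1.\<close>

lemma riemann_function_second_difference:
  assumes "h \<noteq> 0"
  shows "(\<lambda>m. trig_term a b m x * sinc_sq (real m * (pi * h))) sums
    ((riemann_function a b (x + h) + riemann_function a b (x - h) - 2 * riemann_function a b x) / h\<^sup>2)"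
proof -
  define T where "T m y = trig_term a b m y / (2 * pi * real m)\<^sup>2" for m y
  have T: "(\<lambda>m. T m y) sums (\<Sum>m. T m y)" for y
    unfolding T_def by (intro summable_sums summable_trig_term_div_square)
  have "(\<lambda>m. (if m = 0 then a 0 else 0) - (T m (x + h) + T m (x - h) - 2 * T m x) / h\<^sup>2) sums
      (a 0 - ((\<Sum>m. T m (x + h)) + (\<Sum>m. T m (x - h)) - 2 * (\<Sum>m. T m x)) / h\<^sup>2)"
    by (intro sums_diff sums_divide sums_add sums_mult T sums_single)
  moreover have "a 0 - ((\<Sum>m. T m (x + h)) + (\<Sum>m. T m (x - h)) - 2 * (\<Sum>m. T m x)) / h\<^sup>2 =
      (riemann_function a b (x + h) + riemann_function a b (x - h) - 2 * riemann_function a b x) / h\<^sup>2"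
    using assms unfolding riemann_function_def T_def[symmetric]
    by (simp add: field_simps power2_eq_square)
  moreover have "(if m = 0 then a 0 else 0) - (T m (x + h) + T m (x - h) - 2 * T m x) / h\<^sup>2 =
      trig_term a b m x * sinc_sq (real m * (pi * h))" for m
  proof (cases "m = 0")
    case True
    then show ?thesis by (simp add: T_def trig_term_def)
  next
    case False
    define u v where "u = 2 * pi * real m * x" and "v = real m * (pi * h)"
    have "v \<noteq> 0" using False assms by (simp add: v_def)
    have arg: "2 * pi * real m * (x + h) = u + 2 * v" "2 * pi * real m * (x - h) = u - 2 * v"
      by (simp_all add: u_def v_def algebra_simps)
    have "trig_term a b m (x + h) + trig_term a b m (x - h) - 2 * trig_term a b m x
        = 2 * (cos (2 * v) - 1) * (a m * cos u + b m * sin u)"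
      unfolding trig_term_def arg u_def[symmetric]
      by (simp add: cos_add cos_diff sin_add sin_diff algebra_simps)
    also have "\<dots> = - 4 * (sin v)\<^sup>2 * trig_term a b m x"
      by (simp add: cos_double_sin trig_term_def u_def)
    finally have "T m (x + h) + T m (x - h) - 2 * T m x = - 4 * (sin v)\<^sup>2 * trig_term a b m x / (2 * pi * real m)\<^sup>2"
      unfolding T_def by (simp add: diff_divide_distrib[symmetric] add_divide_distrib[symmetric])
    also have "\<dots> / h\<^sup>2 = - (trig_term a b m x * (sin v / v)\<^sup>2)"
      using False assms by (simp add: v_def field_simps power2_eq_square)
    finally show ?thesis
      using False \<open>v \<noteq> 0\<close> by (simp add: sinc_sq_def v_def)
  qed
  ultimately show ?thesis by simp
qed

text \<open>Riemann summation turns convergence to 0 inside the interval into a vanishing symmetric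
  second derivative; the Riemann function is then affine, up to the end points by continuity. Its
  second difference about the midpoint, with the half length as step, is 0 and is expanded in
  frequencies.\<close>

lemma trig_term_midpoint_sums_0:
  assumes "p < q" and S: "\<And>x. p < x \<Longrightarrow> x < q \<Longrightarrow> (\<lambda>m. trig_term a b m x) sums 0"
  shows "(\<lambda>m. trig_term a b m ((p + q) / 2) * sinc_sq (real m * (pi * ((q - p) / 2)))) sums 0"
proof -
  let ?F = "riemann_function a b"
  have "?F q + ?F p = 2 * ?F ((p + q) / 2)"
    unfolding add.commute[of "?F q"]
  proof (rule symmetric_derivative_zero_imp_midpoint[OF continuous_on_riemann_function \<open>p < q\<close>])
    fix x assume x: "p < x" "x < q"
    show "((\<lambda>h. (?F (x + h) + ?F (x - h) - 2 * ?F x) / h\<^sup>2) \<longlongrightarrow> 0) (at_right 0)"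
    proof (rule tendstoI)
      fix \<epsilon> :: real assume "\<epsilon> > 0"
      have "filterlim (\<lambda>h. pi * h) (at_right 0) (at_right 0)"
        by real_asymp
      moreover have "\<forall>\<^sub>F h in at_right 0. \<forall>\<^sub>F M in sequentially. \<bar>\<Sum>m<M. trig_term a b m x * sinc_sq (real m * h)\<bar> \<le> \<epsilon> / 2"
        using riemann_summation_bound[OF S[OF x], of "\<epsilon> / 2"] \<open>\<epsilon> > 0\<close> by simp
      ultimately have "\<forall>\<^sub>F h in at_right 0. \<forall>\<^sub>F M in sequentially. \<bar>\<Sum>m<M. trig_term a b m x * sinc_sq (real m * (pi * h))\<bar> \<le> \<epsilon> / 2"
        by (rule eventually_compose_filterlim[rotated])
      moreover have "\<forall>\<^sub>F h in at_right 0. h > (0::real)"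
        by (simp add: eventually_at_right_less)
      ultimately show "\<forall>\<^sub>F h in at_right 0. dist ((?F (x + h) + ?F (x - h) - 2 * ?F x) / h\<^sup>2) 0 < \<epsilon>"
      proof eventually_elim
        fix h :: real
        assume h: "\<forall>\<^sub>F M in sequentially. \<bar>\<Sum>m<M. trig_term a b m x * sinc_sq (real m * (pi * h))\<bar> \<le> \<epsilon> / 2" "h > 0"
        have "(\<lambda>M. \<bar>\<Sum>m<M. trig_term a b m x * sinc_sq (real m * (pi * h))\<bar>) \<longlonglongrightarrow> \<bar>(?F (x + h) + ?F (x - h) - 2 * ?F x) / h\<^sup>2\<bar>"
          using riemann_function_second_difference[of h x] h(2) unfolding sums_def by (intro tendsto_rabs) simp
        from tendsto_upperbound[OF this h(1) sequentially_bot] show "dist ((?F (x + h) + ?F (x - h) - 2 * ?F x) / h\<^sup>2) 0 < \<epsilon>"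
          using \<open>\<epsilon> > 0\<close> unfolding dist_real_def diff_0_right by linarith
      qed
    qed
  qed
  moreover have "(p + q) / 2 + (q - p) / 2 = q" "(p + q) / 2 - (q - p) / 2 = p"
    by (simp_all add: field_simps)
  ultimately show ?thesis
    using riemann_function_second_difference[of "(q - p) / 2" "(p + q) / 2"] \<open>p < q\<close> by simp
qed

end

section \<open>Averaging characters over shifted roots of unity\<close>

lemma sum_cis_shifted_roots:
  fixes d :: int
  assumes "n > 0" "\<not> int n dvd d"
  shows "(\<Sum>j<n. cis (2 * pi * of_int d * ((real j + c) / real n))) = 0"
proof -
  \<comment> \<open>The shift c contributes only a constant factor; what remains is the geometric
    sum of a root of unity, nontrivial because n does not divide d.\<close>
  define z where "z = cis (2 * pi * of_int d / real n)"
  have "cis (2 * pi * of_int d * ((real j + c) / real n)) = cis (2 * pi * of_int d * c / real n) * z ^ j" for j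
  proof -
    have "2 * pi * of_int d * ((real j + c) / real n) = 2 * pi * of_int d * c / real n + real j * (2 * pi * of_int d / real n)"
      using \<open>n > 0\<close> by (simp add: field_simps)
    then show ?thesis
      by (simp only: z_def Complex.DeMoivre cis_mult)
  qed
  then have "(\<Sum>j<n. cis (2 * pi * of_int d * ((real j + c) / real n))) = cis (2 * pi * of_int d * c / real n) * (\<Sum>j<n. z ^ j)"
    by (simp add: sum_distrib_left)
  moreover have "z \<noteq> 1"
  proof
    assume "z = 1"
    then have "cos (2 * pi * of_int d / real n) = 1"
      by (simp add: z_def complex_eq_iff)
    then obtain k :: int where "2 * pi * of_int d / real n = of_int k * 2 * pi"
      using cos_one_2pi_int by blast
    then have "of_int d = (of_int k :: real) * real n"
      using \<open>n > 0\<close> by (simp add: field_simps)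
    then have "(of_int d :: real) = of_int (k * int n)"
      by simp
    then have "d = k * int n"
      by (simp only: of_int_eq_iff)
    then show False using assms(2) by simp
  qed
  moreover have "z ^ n = 1"
    using \<open>n > 0\<close> cis_multiple_2pi[of "of_int d"] unfolding z_def Complex.DeMoivre by simp
  ultimately show ?thesis
    by (simp add: geometric_sum)
qed

text \<open>Splitting into the frequencies m and - m lets the average against a character be
  evaluated on each of them separately.\<close>

lemma of_real_trig_term:
  "of_real (trig_term a b m x) =
    (Complex (a m) (- b m) * cis (2 * pi * real m * x) + cnj (Complex (a m) (- b m)) * cis (- (2 * pi * real m * x))) / 2"
  by (simp add: complex_eq_iff trig_term_def field_simps)

lemma card_dvd_interval_le_1:
  fixes c :: int
  shows "card {m \<in> {k..<k + n}. int n dvd int m + c} \<le> 1"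
proof (rule card_le_Suc0_iff_eq[THEN iffD2, folded One_nat_def])
  show "\<forall>m\<in>{m \<in> {k..<k + n}. int n dvd int m + c}. \<forall>m'\<in>{m \<in> {k..<k + n}. int n dvd int m + c}. m = m'"
  proof (intro ballI)
    fix m m' assume m: "m \<in> {m \<in> {k..<k + n}. int n dvd int m + c}" "m' \<in> {m \<in> {k..<k + n}. int n dvd int m + c}"
    then have "int n dvd (int m + c) - (int m' + c)"
      by (intro dvd_diff) auto
    then have "int n dvd int m - int m'" by simp
    moreover have "\<bar>int m - int m'\<bar> < int n" using m by auto
    ultimately have "int m - int m' = 0"
      using dvd_imp_le_int[of "int m - int m'" "int n"] by linarith
    then show "m = m'" by simp
  qed
qed auto

section \<open>Uniqueness for H-sets\<close>

text \<open>The points \<open>(j + 3/4) / n\<close> are the midpoints of the gaps \<open>((j + 1/2) / n, (j + 1) / n)\<close>, and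
  \<open>1 / (4 n)\<close> is half the length of a gap.\<close>

lemma rajchman_coefficient_estimate:
  fixes a b :: "nat \<Rightarrow> real" and n l N :: nat
  defines "\<gamma> \<equiv> \<lambda>m. Complex (a m) (- b m)"
  assumes n: "2 * l < n" "N + l \<le> n" and b0: "b 0 = 0"
    and \<epsilon>: "\<And>m. N \<le> m \<Longrightarrow> norm (\<gamma> m) \<le> \<epsilon>"
    and sums: "\<And>j. j < n \<Longrightarrow>
      (\<lambda>m. trig_term a b m ((real j + 3 / 4) / real n) * sinc_sq (real m * (pi / (4 * real n)))) sums 0"
  shows "norm (\<gamma> l) * sinc_sq (real l * (pi / (4 * real n))) \<le> 24 * \<epsilon>"
proof -
  have "n > 0" using n by simp
  have "\<epsilon> \<ge> 0" using \<epsilon>[of N] norm_ge_zero order_trans by blast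
  define x where "x j = (real j + 3 / 4) / real n" for j
  define w where "w m = sinc_sq (real m * (pi / (4 * real n)))" for m
  define Z where "Z d = (\<Sum>j<n. cis (2 * pi * of_int d * x j))" for d :: int
  \<comment> \<open>The unweighted contribution of frequency m when the sums at the n midpoints are
    paired with the l-th character.\<close>
  define U where "U m = (\<Sum>j<n. of_real (trig_term a b m (x j)) * cis (- (2 * pi * real l * x j)))" for m
  \<comment> \<open>With \<open>c = - int l\<close> this marks the m congruent to l modulo n, with
    \<open>c = int l\<close> those congruent to - l.\<close>
  define e where "e c m = (if int n dvd int m + c then 1 else 0 :: real)" for c m
  have w: "0 \<le> w m" "w m \<le> 1" for m
    unfolding w_def by (simp_all add: sinc_sq_nonneg sinc_sq_le_1)

  have normZ: "norm (Z d) \<le> real n" for d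
  proof -
    have "norm (Z d) \<le> (\<Sum>j<n. norm (cis (2 * pi * of_int d * x j)))"
      unfolding Z_def by (rule norm_sum)
    then show ?thesis by simp
  qed
  have Z0: "Z d = 0" if "\<not> int n dvd d" for d
    unfolding Z_def x_def using sum_cis_shifted_roots[OF \<open>n > 0\<close> that] .
  have U_eq: "U m = (\<gamma> m * Z (int m - int l) + cnj (\<gamma> m) * Z (- int m - int l)) / 2" for m
  proof -
    have "of_real (trig_term a b m (x j)) * cis (- (2 * pi * real l * x j)) =
        (\<gamma> m * cis (2 * pi * of_int (int m - int l) * x j) + cnj (\<gamma> m) * cis (2 * pi * of_int (- int m - int l) * x j)) / 2" for j
    proof -
      have 1: "2 * pi * of_int (int m - int l) * x j = 2 * pi * real m * x j + (- (2 * pi * real l * x j))"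
        "2 * pi * of_int (- int m - int l) * x j = - (2 * pi * real m * x j) + (- (2 * pi * real l * x j))"
        by (simp_all add: algebra_simps)
      show ?thesis
        unfolding of_real_trig_term \<gamma>_def 1 cis_mult[symmetric] by (simp add: algebra_simps)
    qed
    then show ?thesis
      unfolding U_def Z_def sum_distrib_left sum.distrib[symmetric] sum_divide_distrib by (simp only:)
  qed
  have norm_U: "norm (U m) \<le> real n * norm (\<gamma> m) * ((e (- int l) m + e (int l) m) / 2)" for m
  proof -
    have 1: "norm (Z (int m - int l)) \<le> real n * e (- int l) m"
      using normZ[of "int m - int l"] Z0[of "int m - int l"] by (auto simp: e_def)
    have "- int m - int l = - (int m + int l)" by simp
    then have "int n dvd (- int m - int l) \<longleftrightarrow> int n dvd (int m + int l)"
      by (metis dvd_minus_iff)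
    then have 2: "norm (Z (- int m - int l)) \<le> real n * e (int l) m"
      using normZ[of "- int m - int l"] Z0[of "- int m - int l"] by (auto simp: e_def)
    have "norm (U m) \<le> (norm (\<gamma> m * Z (int m - int l)) + norm (cnj (\<gamma> m) * Z (- int m - int l))) / 2"
      unfolding U_eq norm_divide using norm_triangle_ineq by (simp add: divide_right_mono)
    also have "\<dots> \<le> (norm (\<gamma> m) * (real n * e (- int l) m) + norm (\<gamma> m) * (real n * e (int l) m)) / 2"
      unfolding norm_mult complex_mod_cnj using 1 2 by (intro divide_right_mono add_mono mult_left_mono) auto
    finally show ?thesis by (simp add: algebra_simps)
  qed
  have e01: "0 \<le> e c m" for c m by (simp add: e_def)

  text \<open>Apart from \<open>m = l\<close>, only frequencies \<open>m \<ge> n - l\<close> survive the averaging.\<close>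
  have norm_U': "norm (U m * of_real (w m)) \<le> real n * \<epsilon> * ((e (- int l) m + e (int l) m) / 2) * w m" if "m \<noteq> l" for m
  proof (cases "N \<le> m")
    case True
    have "norm (U m) \<le> real n * \<epsilon> * ((e (- int l) m + e (int l) m) / 2)"
      by (rule order_trans[OF norm_U])
        (intro mult_right_mono mult_left_mono \<epsilon> True, auto intro!: add_nonneg_nonneg e01)
    then show ?thesis
      unfolding norm_mult norm_of_real abs_of_nonneg[OF w(1)] by (rule mult_right_mono[OF _ w(1)])
  next
    case False
    have "\<not> int n dvd int m + int l"
    proof
      assume "int n dvd int m + int l"
      then have "int n \<le> int m + int l"
        using \<open>m \<noteq> l\<close> by (intro zdvd_imp_le) auto
      then show False using False n by linarith
    qed
    moreover have "\<not> int n dvd int m + - int l"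
    proof
      assume "int n dvd int m + - int l"
      then have "int n \<le> \<bar>int m + - int l\<bar>"
        using \<open>m \<noteq> l\<close> dvd_imp_le_int[of "int m + - int l" "int n"] by auto
      then show False using False n by linarith
    qed
    ultimately have "U m = 0"
      using norm_U[of m] by (simp add: e_def)
    moreover have "0 \<le> real n * \<epsilon> * ((e (- int l) m + e (int l) m) / 2) * w m"
      using \<open>\<epsilon> \<ge> 0\<close> w[of m] e01 by (intro mult_nonneg_nonneg divide_nonneg_nonneg add_nonneg_nonneg) auto
    ultimately show ?thesis by simp
  qed
  \<comment> \<open>A window of n consecutive frequencies meets each of the two residue classes at
    most once.\<close>
  have sum_e: "(\<Sum>m=k..<k+n. (e (- int l) m + e (int l) m) / 2) \<le> 1" for k
  proof -
    have "(\<Sum>m=k..<k+n. e c m) \<le> 1" for c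
    proof -
      have "(\<Sum>m=k..<k+n. e c m) = real (card {m \<in> {k..<k + n}. int n dvd int m + c})"
        unfolding e_def by (simp add: sum.If_cases Int_def)
      then show ?thesis
        using card_dvd_interval_le_1[of k n c] by simp
    qed
    from this[of "- int l"] this[of "int l"] show ?thesis
      by (simp add: sum_divide_distrib[symmetric] sum.distrib)
  qed
  \<comment> \<open>For l = 0 the frequencies l and - l coincide and \<open>b 0 = 0\<close> makes
    the coefficient real, so the full factor n appears. For l > 0 the bound \<open>2 * l < n\<close>
    excludes a resonance of - 2 l, which leaves half of it.\<close>
  have U_l: "real n * norm (\<gamma> l) / 2 \<le> norm (U l)"
  proof -
    have Zl: "Z (int l - int l) = of_nat n" by (simp add: Z_def)
    show ?thesis
    proof (cases "l = 0")
      case True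
      then have "U l = of_nat n * \<gamma> l"
        unfolding U_eq using b0 by (simp add: Z_def \<gamma>_def complex_eq_iff)
      then show ?thesis by (simp add: norm_mult)
    next
      case False
      have "\<not> int n dvd - int l - int l"
        using False n(1) zdvd_not_zless[of "2 * int l" "int n"] dvd_minus_iff[of "int n" "2 * int l"] by auto
      then have "U l = of_nat n * \<gamma> l / 2"
        unfolding U_eq Zl using Z0 by simp
      then show ?thesis by (simp only: norm_mult norm_divide) simp
    qed
  qed

  \<comment> \<open>Blocks of length n contain at most two resonant frequencies each; l itself lies
    in block 0.\<close>
  define V where "V q = (\<Sum>m=q*n..<q*n+n. U m * of_real (w m))" for q
  have "(\<lambda>m. \<Sum>j<n. of_real (trig_term a b m (x j) * w m) * cis (- (2 * pi * real l * x j))) sums (\<Sum>j<n. 0)"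
  proof (intro sums_sum)
    fix j assume "j \<in> {..<n}"
    then have "(\<lambda>m. of_real (trig_term a b m (x j) * w m) * cis (- (2 * pi * real l * x j))) sums
        (of_real 0 * cis (- (2 * pi * real l * x j)))"
      unfolding x_def w_def by (intro sums_mult2 sums_of_real sums) simp
    then show "(\<lambda>m. of_real (trig_term a b m (x j) * w m) * cis (- (2 * pi * real l * x j))) sums 0"
      by simp
  qed
  moreover have "(\<Sum>j<n. of_real (trig_term a b m (x j) * w m) * cis (- (2 * pi * real l * x j))) = U m * of_real (w m)" for m
    unfolding U_def sum_distrib_right by (intro sum.cong refl) (simp add: mult_ac)
  ultimately have "(\<lambda>m. U m * of_real (w m)) sums 0"
    by simp
  from sums_group[OF this \<open>n > 0\<close>] have V: "V sums 0"
    unfolding V_def[abs_def] .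
  then have V_Suc: "(\<lambda>q. V (Suc q)) sums (- V 0)"
    using sums_Suc_iff[of V "- V 0"] by simp
  \<comment> \<open>In block q + 1 the argument of the kernel is at least (q + 1) pi / 4, hence at
    least (q + 1) / 2, so the weights are at most 4 / (q + 1)^2.\<close>
  have norm_V: "norm (V (Suc q)) \<le> 4 * real n * \<epsilon> * (1 / (real q + 1)\<^sup>2)" for q
  proof -
    let ?I = "{Suc q * n..<Suc q * n + n}"
    have w_le: "w m \<le> 4 * (1 / (real q + 1)\<^sup>2)" if m: "m \<in> ?I" for m
    proof -
      have "real (Suc q * n) \<le> real m"
        using m by (simp only: of_nat_le_iff) auto
      then have "(real q + 1) * real n * (pi / (4 * real n)) \<le> real m * (pi / (4 * real n))"
        by (intro mult_right_mono) (auto simp: algebra_simps)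
      moreover have "(real q + 1) * real n * (pi / (4 * real n)) = (real q + 1) * (pi / 4)"
        using \<open>n > 0\<close> by simp
      moreover have "(real q + 1) * (1 / 2) \<le> (real q + 1) * (pi / 4)"
        using pi_ge_two by (intro mult_left_mono) auto
      ultimately have le: "(real q + 1) / 2 \<le> real m * (pi / (4 * real n))"
        by linarith
      have "m > 0" using m \<open>n > 0\<close> by (cases m) auto
      then have "w m \<le> 1 / (real m * (pi / (4 * real n)))\<^sup>2"
        unfolding w_def using \<open>n > 0\<close> by (intro sinc_sq_le_inverse_square) simp
      also have "\<dots> \<le> 1 / ((real q + 1) / 2)\<^sup>2"
        using le \<open>m > 0\<close> \<open>n > 0\<close> by (intro divide_left_mono power_mono mult_pos_pos zero_less_power divide_pos_pos) auto
      finally show ?thesis by (simp add: power_divide)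
    qed
    have "norm (V (Suc q)) \<le> (\<Sum>m\<in>?I. norm (U m * of_real (w m)))"
      unfolding V_def by (rule norm_sum)
    also have "\<dots> \<le> (\<Sum>m\<in>?I. real n * \<epsilon> * ((e (- int l) m + e (int l) m) / 2) * (4 * (1 / (real q + 1)\<^sup>2)))"
    proof (rule sum_mono)
      fix m assume m: "m \<in> ?I"
      then have "m \<noteq> l" using n(1) by auto
      then have "norm (U m * of_real (w m)) \<le> real n * \<epsilon> * ((e (- int l) m + e (int l) m) / 2) * w m"
        by (rule norm_U')
      also have "\<dots> \<le> real n * \<epsilon> * ((e (- int l) m + e (int l) m) / 2) * (4 * (1 / (real q + 1)\<^sup>2))"
        using w_le[OF m] \<open>\<epsilon> \<ge> 0\<close> e01 by (intro mult_left_mono mult_nonneg_nonneg divide_nonneg_nonneg add_nonneg_nonneg) auto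
      finally show "norm (U m * of_real (w m)) \<le> real n * \<epsilon> * ((e (- int l) m + e (int l) m) / 2) * (4 * (1 / (real q + 1)\<^sup>2))" .
    qed
    also have "\<dots> = (4 * real n * \<epsilon> * (1 / (real q + 1)\<^sup>2)) * (\<Sum>m\<in>?I. (e (- int l) m + e (int l) m) / 2)"
      unfolding sum_distrib_left by (intro sum.cong refl) (simp only: mult_ac)
    also have "\<dots> \<le> (4 * real n * \<epsilon> * (1 / (real q + 1)\<^sup>2)) * 1"
      using sum_e[of "Suc q * n"] \<open>\<epsilon> \<ge> 0\<close> by (intro mult_left_mono) auto
    finally show ?thesis by simp
  qed
  have sq: "(\<lambda>q. 4 * real n * \<epsilon> * (1 / (real q + 1)\<^sup>2)) sums (4 * real n * \<epsilon> * (pi\<^sup>2 / 6))"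
    using inverse_squares_sums by (intro sums_mult) (simp add: add.commute)
  have summ: "summable (\<lambda>q. norm (V (Suc q)))"
    by (rule summable_comparison_test'[OF sums_summable[OF sq], of 0]) (use norm_V in simp)
  have "norm (V 0) = norm (\<Sum>q. V (Suc q))"
    using sums_unique[OF V_Suc] by (metis norm_minus_cancel)
  also have "\<dots> \<le> (\<Sum>q. norm (V (Suc q)))"
    by (rule summable_norm[OF summ])
  also have "\<dots> \<le> 4 * real n * \<epsilon> * (pi\<^sup>2 / 6)"
    using suminf_le[OF norm_V summ sums_summable[OF sq]] sums_unique[OF sq] by simp
  also have "\<dots> \<le> 4 * real n * \<epsilon> * (16 / 6)"
  proof -
    have "pi\<^sup>2 \<le> 4\<^sup>2"
      using pi_less_4 pi_gt_zero by (intro power_mono) auto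
    then show ?thesis
      using \<open>\<epsilon> \<ge> 0\<close> by (intro mult_left_mono divide_right_mono) auto
  qed
  finally have V0: "norm (V 0) \<le> 4 * real n * \<epsilon> * (16 / 6)" .

  have "V 0 = U l * of_real (w l) + (\<Sum>m\<in>{0..<n} - {l}. U m * of_real (w m))"
    unfolding V_def using n(1) sum.remove[of "{0..<n}" l "\<lambda>m. U m * of_real (w m)"] by simp
  moreover have "norm (\<Sum>m\<in>{0..<n} - {l}. U m * of_real (w m)) \<le> real n * \<epsilon>"
  proof -
    have "norm (\<Sum>m\<in>{0..<n} - {l}. U m * of_real (w m)) \<le> (\<Sum>m\<in>{0..<n} - {l}. norm (U m * of_real (w m)))"
      by (rule norm_sum)
    also have "\<dots> \<le> (\<Sum>m\<in>{0..<n} - {l}. real n * \<epsilon> * ((e (- int l) m + e (int l) m) / 2))"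
    proof (rule sum_mono)
      fix m assume "m \<in> {0..<n} - {l}"
      then have "norm (U m * of_real (w m)) \<le> real n * \<epsilon> * ((e (- int l) m + e (int l) m) / 2) * w m"
        by (intro norm_U') auto
      also have "\<dots> \<le> real n * \<epsilon> * ((e (- int l) m + e (int l) m) / 2) * 1"
        using w[of m] \<open>\<epsilon> \<ge> 0\<close> e01 by (intro mult_left_mono mult_nonneg_nonneg divide_nonneg_nonneg add_nonneg_nonneg) auto
      finally show "norm (U m * of_real (w m)) \<le> real n * \<epsilon> * ((e (- int l) m + e (int l) m) / 2)" by simp
    qed
    also have "\<dots> \<le> (\<Sum>m\<in>{0..<n}. real n * \<epsilon> * ((e (- int l) m + e (int l) m) / 2))"
      using \<open>\<epsilon> \<ge> 0\<close> e01 by (intro sum_mono2 mult_nonneg_nonneg divide_nonneg_nonneg add_nonneg_nonneg) auto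
    also have "\<dots> \<le> real n * \<epsilon> * 1"
      unfolding sum_distrib_left[symmetric] using sum_e[of 0] \<open>\<epsilon> \<ge> 0\<close> by (intro mult_left_mono) auto
    finally show ?thesis by simp
  qed
  ultimately have "norm (U l * of_real (w l)) \<le> norm (V 0) + real n * \<epsilon>"
    by (smt (verit) add_diff_cancel_right' norm_triangle_ineq4)
  \<comment> \<open>4 * 16 / 6 from the blocks after block 0, plus 1 from block 0, is below 12; the
    factor 1 / 2 in \<open>U_l\<close> doubles this to 24.\<close>
  then have "norm (U l) * w l \<le> 12 * real n * \<epsilon>"
  proof -
    assume *: "norm (U l * of_real (w l)) \<le> norm (V 0) + real n * \<epsilon>"
    have "0 \<le> real n * \<epsilon>" using \<open>\<epsilon> \<ge> 0\<close> by simp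
    then show ?thesis
      using V0 w[of l] * unfolding norm_mult norm_of_real by (simp add: mult_ac)
  qed
  moreover have "real n * norm (\<gamma> l) / 2 * w l \<le> norm (U l) * w l"
    using U_l w by (intro mult_right_mono) auto
  ultimately have "real n * (norm (\<gamma> l) * w l) \<le> real n * (24 * \<epsilon>)"
    by (simp add: algebra_simps)
  then show ?thesis
    using \<open>n > 0\<close> unfolding w_def by simp
qed

text \<open>The sign condition says that \<open>n x\<close> avoids the arc \<open>(1/2, 1)\<close> modulo \<open>1\<close>.\<close>

theorem H_set_imp_set_of_uniqueness:
  assumes K: "K \<subseteq> {0..1}"
    and inf: "infinite {n. \<forall>x\<in>K. sin (2 * pi * real n * x) \<ge> 0}" (is "infinite ?H")
  shows "set_of_uniqueness K"
  unfolding set_of_uniqueness_def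
proof (intro conjI allI impI K)
  fix a b' :: "nat \<Rightarrow> real"
  assume off: "\<forall>x\<in>{0..1} - K. (\<lambda>n. a n * cos (2 * pi * real n * x) + b' n * sin (2 * pi * real n * x)) sums 0"
  \<comment> \<open>The value \<open>b' 0\<close> multiplies sin 0 and is arbitrary; it is replaced
    by 0 so that \<gamma> 0 is real.\<close>
  define b where "b = b'(0 := 0)"
  define \<gamma> where "\<gamma> m = Complex (a m) (- b m)" for m
  have off_K: "(\<lambda>m. trig_term a b m x) sums 0" if "x \<in> {0..1} - K" for x
  proof -
    have "(\<lambda>m. trig_term a b m x) = (\<lambda>n. a n * cos (2 * pi * real n * x) + b' n * sin (2 * pi * real n * x))"
      by (auto simp: trig_term_def b_def)
    then show ?thesis using off that by simp
  qed
  have gap: "(\<lambda>m. trig_term a b m x) sums 0"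
    if H: "n \<in> ?H" "j < n" and x: "(real j + 1 / 2) / real n < x" "x < (real j + 1) / real n" for n j x
  proof (rule off_K)
    have "n > 0" using H by simp
    have nx: "real j + 1 / 2 < real n * x" "real n * x < real j + 1"
      using x \<open>n > 0\<close> by (simp_all add: field_simps)
    have "sin (2 * pi * real n * x) = - sin (2 * pi * (real j + 1 - real n * x))"
    proof -
      have "2 * pi * (real j + 1 - real n * x) = 2 * real (Suc j) * pi - 2 * pi * real n * x"
        by (simp add: algebra_simps)
      then show ?thesis
        by (simp only: sin_diff sin_2npi cos_2npi)
    qed
    moreover have "sin (2 * pi * (real j + 1 - real n * x)) > 0"
    proof (rule sin_gt_zero)
      show "0 < 2 * pi * (real j + 1 - real n * x)" using nx by simp
      have "2 * pi * (real j + 1 - real n * x) < 2 * pi * (1 / 2)"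
        using nx by (intro mult_strict_left_mono) auto
      then show "2 * pi * (real j + 1 - real n * x) < pi" by simp
    qed
    ultimately have "x \<notin> K" using H by force
    moreover have "0 \<le> x" using nx(1) \<open>n > 0\<close>
      by (smt (verit) mult_nonneg_nonpos of_nat_0_le_iff divide_nonneg_nonneg zero_le_mult_iff)
    moreover have "x \<le> 1"
    proof -
      have "real n * x < real n * 1" using nx(2) H(2) by linarith
      then show ?thesis using \<open>n > 0\<close> by (simp only: mult_less_cancel_left_pos of_nat_0_less_iff)
    qed
    ultimately show "x \<in> {0..1} - K" by simp
  qed

  have \<gamma>_lim: "(\<lambda>m. norm (\<gamma> m)) \<longlonglongrightarrow> 0"
  proof -
    obtain n where n: "n \<in> ?H" "n > 0"
      using inf infinite_nat_iff_unbounded[of ?H] by blast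
    have "(\<lambda>m. (a m)\<^sup>2 + (b m)\<^sup>2) \<longlonglongrightarrow> 0"
    proof (rule cantor_lebesgue)
      \<comment> \<open>A closed interval inside the first open gap, from (1/2) / n to 1 /
        n.\<close>
      show "(5 / 8) / real n < (7 / 8) / real n" using n by (simp add: divide_strict_right_mono)
      fix x assume "x \<in> {(5 / 8) / real n..(7 / 8) / real n}"
      moreover have "(1 / 2) / real n < (5 / 8) / real n" "(7 / 8) / real n < 1 / real n"
        using n(2) by (intro divide_strict_right_mono; simp)+
      ultimately show "(\<lambda>m. trig_term a b m x) \<longlonglongrightarrow> 0"
        using n gap[of n 0 x] by (intro summable_LIMSEQ_zero sums_summable) auto
    qed
    then have "(\<lambda>m. sqrt ((a m)\<^sup>2 + (b m)\<^sup>2)) \<longlonglongrightarrow> sqrt 0"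
      by (intro tendsto_real_sqrt)
    then show ?thesis by (simp add: \<gamma>_def cmod_def)
  qed
  then obtain B where B: "\<And>m. norm (\<gamma> m) \<le> B"
    using convergent_imp_Bseq[of "\<lambda>m. norm (\<gamma> m)"] unfolding convergent_def Bseq_def by auto
  have bounded: "\<bar>a m\<bar> + \<bar>b m\<bar> \<le> 2 * B" for m
    using B[of m] abs_Re_le_cmod[of "\<gamma> m"] abs_Im_le_cmod[of "\<gamma> m"] by (simp add: \<gamma>_def)

  have \<gamma>0: "\<gamma> l = 0" for l
  proof -
    \<comment> \<open>Twice 24, since the kernel at l exceeds 1/2 for large n.\<close>
    have "norm (\<gamma> l) \<le> 48 * \<epsilon>" if "\<epsilon> > 0" for \<epsilon>
    proof -
      obtain N where N: "\<And>m. m \<ge> N \<Longrightarrow> norm (\<gamma> m) \<le> \<epsilon>"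
        using LIMSEQ_D[OF \<gamma>_lim \<open>\<epsilon> > 0\<close>] by (auto intro: less_imp_le)
      have "(\<lambda>n. sinc_sq (real l * (pi / (4 * real n)))) \<longlonglongrightarrow> sinc_sq 0"
        by (intro isCont_tendsto_compose[OF isCont_sinc_sq]) real_asymp
      then have "\<forall>\<^sub>F n in sequentially. sinc_sq (real l * (pi / (4 * real n))) > 1 / 2"
        by (rule order_tendstoD) simp
      then obtain N' where N': "\<And>n. n \<ge> N' \<Longrightarrow> sinc_sq (real l * (pi / (4 * real n))) > 1 / 2"
        unfolding eventually_sequentially by blast
      obtain n where n: "n \<in> ?H" "n > N + 2 * l + N'"
        using inf infinite_nat_iff_unbounded[of ?H] by blast
      then have "n > 0" by simp
      have "norm (\<gamma> l) * sinc_sq (real l * (pi / (4 * real n))) \<le> 24 * \<epsilon>"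
        unfolding \<gamma>_def
      proof (rule rajchman_coefficient_estimate)
        show "2 * l < n" "N + l \<le> n" "b 0 = 0" using n by (auto simp: b_def)
        show "cmod (Complex (a m) (- b m)) \<le> \<epsilon>" if "N \<le> m" for m
          using N[OF that] by (simp add: \<gamma>_def)
        fix j assume j: "j < n"
        have "(real j + 1 / 2) / real n < (real j + 1) / real n"
          using \<open>n > 0\<close> by (intro divide_strict_right_mono) auto
        note trig_term_midpoint_sums_0[OF bounded this gap[OF n(1) j]]
        moreover have "((real j + 1 / 2) / real n + (real j + 1) / real n) / 2 = (real j + 3 / 4) / real n"
          "pi * (((real j + 1) / real n - (real j + 1 / 2) / real n) / 2) = pi / (4 * real n)"
          using \<open>n > 0\<close> by (simp_all add: field_simps)
        ultimately show "(\<lambda>m. trig_term a b m ((real j + 3 / 4) / real n) * sinc_sq (real m * (pi / (4 * real n)))) sums 0"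
          by simp
      qed
      moreover have "norm (\<gamma> l) * (1 / 2) \<le> norm (\<gamma> l) * sinc_sq (real l * (pi / (4 * real n)))"
        using N'[of n] n by (intro mult_left_mono) auto
      ultimately show ?thesis by linarith
    qed
    \<comment> \<open>With this choice the norm is at most half of itself.\<close>
    from this[of "norm (\<gamma> l) / 96"] show ?thesis
      by (cases "\<gamma> l = 0") auto
  qed
  show "a n = 0" for n
    using \<gamma>0[of n] by (simp add: \<gamma>_def complex_eq_iff)
  show "b' n = 0" if "n \<ge> 1" for n
    using \<gamma>0[of n] that by (simp add: \<gamma>_def complex_eq_iff b_def)
qed

section \<open>Erasing binary digits\<close>

text \<open>The dyadic intervals from p n / 2^n to (p n + 1) / 2^n are nested, so every left end
  lies below every right end.\<close>

lemma binary_prefix_limit: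
  fixes p :: "nat \<Rightarrow> nat"
  assumes p: "\<And>n. 2 * p n \<le> p (Suc n)" "\<And>n. p (Suc n) \<le> 2 * p n + 1"
  obtains X where "(\<lambda>n. real (p n) / 2 ^ n) \<longlonglongrightarrow> X"
    "\<And>n. real (p n) / 2 ^ n \<le> X" "\<And>n. X \<le> (real (p n) + 1) / 2 ^ n"
proof -
  have inc: "incseq (\<lambda>n. real (p n) / 2 ^ n)"
  proof (rule incseq_SucI)
    fix n
    have "2 * real (p n) \<le> real (p (Suc n))"
      using p(1)[of n] by linarith
    then show "real (p n) / 2 ^ n \<le> real (p (Suc n)) / 2 ^ Suc n"
      by (simp add: field_simps)
  qed
  have dec: "decseq (\<lambda>n. (real (p n) + 1) / 2 ^ n)"
  proof (rule decseq_SucI)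
    fix n
    have "real (p (Suc n)) + 1 \<le> 2 * (real (p n) + 1)"
      using p(2)[of n] by (simp add: of_nat_le_iff[where 'a = real, symmetric] del: of_nat_le_iff)
    then have "(real (p (Suc n)) + 1) / 2 ^ Suc n \<le> 2 * (real (p n) + 1) / 2 ^ Suc n"
      by (intro divide_right_mono) auto
    then show "(real (p (Suc n)) + 1) / 2 ^ Suc n \<le> (real (p n) + 1) / 2 ^ n"
      by (simp only: power_Suc mult_divide_mult_cancel_left_if) simp
  qed
  have le: "real (p m) / 2 ^ m \<le> (real (p n) + 1) / 2 ^ n" for m n
  proof -
    have "real (p m) / 2 ^ m \<le> real (p (max m n)) / 2 ^ (max m n)"
      by (rule incseqD[OF inc]) simp
    also have "\<dots> \<le> (real (p (max m n)) + 1) / 2 ^ (max m n)"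
      by (simp add: divide_right_mono)
    also have "\<dots> \<le> (real (p n) + 1) / 2 ^ n"
      by (rule decseqD[OF dec]) simp
    finally show ?thesis .
  qed
  obtain X where X: "(\<lambda>n. real (p n) / 2 ^ n) \<longlonglongrightarrow> X" "\<And>n. real (p n) / 2 ^ n \<le> X"
    using incseq_convergent[OF inc, of "(real (p 0) + 1) / 2 ^ 0"] le[of _ 0] by auto
  moreover have "X \<le> (real (p n) + 1) / 2 ^ n" for n
    by (rule LIMSEQ_le_const2[OF X(1)]) (use le in auto)
  ultimately show ?thesis using that by blast
qed

text \<open>\<open>mask S n a\<close> reads \<open>a\<close> as a string of \<open>n\<close> binary digits, numbered from \<open>0\<close> with the most
  significant one first, and erases the digits with index in \<open>S\<close>.\<close>

fun mask :: "nat set \<Rightarrow> nat \<Rightarrow> nat \<Rightarrow> nat" where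
  "mask S 0 a = 0"
| "mask S (Suc n) a = 2 * mask S n (a div 2) + (if n \<in> S then 0 else a mod 2)"

text \<open>Each erased position leaves at most two choices for the digit of a preimage; every other
  digit is dictated by j.\<close>

lemma card_mask_fiber_le: "card {a. a < 2 ^ n \<and> mask S n a = j} \<le> 2 ^ card (S \<inter> {..<n})"
proof (induction n arbitrary: j)
  case 0
  have "card {a::nat. a < 2 ^ 0 \<and> mask S 0 a = j} \<le> card {0::nat}"
    by (intro card_mono) auto
  then show ?case by simp
next
  case (Suc n)
  let ?A = "\<lambda>n j. {a. a < 2 ^ n \<and> mask S n a = j}"
  have fin: "finite (?A n j)" for n j
    by (rule finite_subset[of _ "{..<2 ^ n}"]) auto
  show ?case
  proof (cases "n \<in> S")
    case True
    have "card (?A (Suc n) j) \<le> card (?A n (j div 2) \<times> {0, 1::nat})"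
    proof (rule card_inj_on_le[of "\<lambda>a. (a div 2, a mod 2)"])
      show "inj_on (\<lambda>a. (a div 2, a mod 2)) (?A (Suc n) j)"
        by (rule inj_onI) (metis Pair_inject div_mult_mod_eq)
      show "(\<lambda>a. (a div 2, a mod 2)) ` ?A (Suc n) j \<subseteq> ?A n (j div 2) \<times> {0, 1}"
        using True by auto
    qed (use fin in auto)
    also have "\<dots> \<le> 2 ^ card (S \<inter> {..<n}) * 2"
      unfolding card_cartesian_product using Suc.IH[of "j div 2"] by simp
    also have "S \<inter> {..<Suc n} = insert n (S \<inter> {..<n})"
      using True by auto
    then have "2 ^ card (S \<inter> {..<n}) * 2 = (2::nat) ^ card (S \<inter> {..<Suc n})"
      by simp
    finally show ?thesis .
  next
    case False
    have "card (?A (Suc n) j) \<le> card (?A n (j div 2))"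
    proof (rule card_inj_on_le[of "\<lambda>a. a div 2"])
      have mod: "a mod 2 = j mod 2" if "a \<in> ?A (Suc n) j" for a
        using that False by auto
      show "inj_on (\<lambda>a. a div 2) (?A (Suc n) j)"
      proof (rule inj_onI)
        fix a a' assume "a \<in> ?A (Suc n) j" "a' \<in> ?A (Suc n) j" "a div 2 = a' div 2"
        then show "a = a'" using mod by (metis div_mult_mod_eq)
      qed
      show "(\<lambda>a. a div 2) ` ?A (Suc n) j \<subseteq> ?A n (j div 2)"
        using False by auto
    qed (use fin in auto)
    also have "\<dots> \<le> 2 ^ card (S \<inter> {..<n})" by (rule Suc.IH)
    also have "S \<inter> {..<n} = S \<inter> {..<Suc n}"
      using False by (auto simp: less_Suc_eq)
    finally show ?thesis .
  qed
qed

lemma mod2_le: "a mod 2 \<le> Suc 0" for a :: nat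
  by linarith

definition masked_prefix :: "nat set \<Rightarrow> nat \<Rightarrow> real \<Rightarrow> nat" where
  "masked_prefix S n t = mask S n (nat \<lfloor>2 ^ n * t\<rfloor>)"

lemma masked_prefix_Suc:
  "masked_prefix S (Suc n) t = 2 * masked_prefix S n t + (if n \<in> S then 0 else nat \<lfloor>2 ^ Suc n * t\<rfloor> mod 2)"
proof -
  have "\<lfloor>2 ^ n * t\<rfloor> = \<lfloor>2 ^ Suc n * t\<rfloor> div 2"
    using floor_divide_real_eq_div[of 2 "2 ^ Suc n * t"] by simp
  then have "nat \<lfloor>2 ^ n * t\<rfloor> = nat \<lfloor>2 ^ Suc n * t\<rfloor> div 2"
    by (simp add: nat_div_distrib')
  then show ?thesis
    by (simp add: masked_prefix_def)
qed

lemma measurable_masked_prefix [measurable]: "masked_prefix S n \<in> measurable borel (count_space UNIV)"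
  unfolding masked_prefix_def by measurable

definition masked_real :: "nat set \<Rightarrow> real \<Rightarrow> real" where
  "masked_real S t = lim (\<lambda>n. real (masked_prefix S n t) / 2 ^ n)"

lemma measurable_masked_real [measurable]: "masked_real S \<in> borel_measurable borel"
  unfolding masked_real_def by measurable

lemma masked_real_bounds:
  "real (masked_prefix S n t) / 2 ^ n \<le> masked_real S t"
  "masked_real S t \<le> (real (masked_prefix S n t) + 1) / 2 ^ n"
proof -
  obtain X where "(\<lambda>n. real (masked_prefix S n t) / 2 ^ n) \<longlonglongrightarrow> X"
    "\<And>n. real (masked_prefix S n t) / 2 ^ n \<le> X" "\<And>n. X \<le> (real (masked_prefix S n t) + 1) / 2 ^ n"
  proof (rule binary_prefix_limit[of "\<lambda>n. masked_prefix S n t"])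
    show "2 * masked_prefix S n t \<le> masked_prefix S (Suc n) t"
      "masked_prefix S (Suc n) t \<le> 2 * masked_prefix S n t + 1" for n
      by (simp_all add: masked_prefix_Suc mod2_le)
  qed auto
  then show "real (masked_prefix S n t) / 2 ^ n \<le> masked_real S t"
    "masked_real S t \<le> (real (masked_prefix S n t) + 1) / 2 ^ n"
    unfolding masked_real_def by (metis limI)+
qed

text \<open>A digit 0 at position s puts the point into the closed left half of its dyadic interval
  of level s. This yields the sign of the sine and, through the remaining room of 1/2, the exclusion
  of expansions ending in 1's.\<close>

lemma masked_real_erased_digit:
  assumes "s \<in> S"
  shows "real (masked_prefix S s t) \<le> 2 ^ s * masked_real S t"
    "2 ^ s * masked_real S t \<le> real (masked_prefix S s t) + 1 / 2"
proof -
  have "masked_prefix S (Suc s) t = 2 * masked_prefix S s t"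
    using assms by (simp add: masked_prefix_Suc)
  then show "real (masked_prefix S s t) \<le> 2 ^ s * masked_real S t"
    "2 ^ s * masked_real S t \<le> real (masked_prefix S s t) + 1 / 2"
    using masked_real_bounds[where n = "Suc s" and S = S and t = t] by (simp_all add: field_simps)
qed

text \<open>Infinitely many erased digits exclude an expansion ending in \<open>111\<dots>\<close>, so prefixes can be read off.\<close>

lemma floor_masked_real:
  assumes "infinite S"
  shows "\<lfloor>2 ^ n * masked_real S t\<rfloor> = int (masked_prefix S n t)"
proof -
  obtain s where s: "s \<in> S" "n < s"
    using assms infinite_nat_iff_unbounded by blast
  have mono: "masked_prefix S (n + k) t + 1 \<le> 2 ^ k * (masked_prefix S n t + 1)" for k
  proof (induction k)
    case (Suc k)
    have "masked_prefix S (n + Suc k) t \<le> 2 * masked_prefix S (n + k) t + 1"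
      by (simp add: masked_prefix_Suc mod2_le)
    then show ?case using Suc by simp
  qed simp
  have "masked_prefix S s t + 1 \<le> 2 ^ (s - n) * (masked_prefix S n t + 1)"
    using mono[of "s - n"] s by simp
  then have "real (masked_prefix S s t + 1) \<le> real (2 ^ (s - n) * (masked_prefix S n t + 1))"
    by (simp only: of_nat_le_iff)
  then have "real (masked_prefix S s t) + 1 \<le> 2 ^ (s - n) * (real (masked_prefix S n t) + 1)"
    by (simp add: algebra_simps)
  \<comment> \<open>Strictness comes from the 1/2 left over at the erased position s beyond
    n.\<close>
  then have "2 ^ s * masked_real S t < 2 ^ (s - n) * (real (masked_prefix S n t) + 1)"
    using masked_real_erased_digit(2)[OF s(1), of t] by linarith
  moreover have "(2::real) ^ s = 2 ^ (s - n) * 2 ^ n"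
    using s by (simp add: power_add[symmetric])
  ultimately have "2 ^ n * masked_real S t < real (masked_prefix S n t) + 1"
    by (simp add: mult.assoc)
  moreover have "real (masked_prefix S n t) \<le> 2 ^ n * masked_real S t"
    using masked_real_bounds(1)[where n = n and S = S and t = t] by (simp add: field_simps)
  ultimately show ?thesis
    by (intro floor_unique) auto
qed

section \<open>Masses of dyadic cells and short intervals\<close>

lemma emeasure_floor_fiber:
  "emeasure lborel {t::real. 0 \<le> t \<and> t < 1 \<and> nat \<lfloor>2 ^ n * t\<rfloor> = a} \<le> ennreal (1 / 2 ^ n)"
proof -
  have "emeasure lborel {t::real. 0 \<le> t \<and> t < 1 \<and> nat \<lfloor>2 ^ n * t\<rfloor> = a}
      \<le> emeasure lborel {real a / 2 ^ n..(real a + 1) / 2 ^ n}"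
  proof (rule emeasure_mono)
    show "{t::real. 0 \<le> t \<and> t < 1 \<and> nat \<lfloor>2 ^ n * t\<rfloor> = a} \<subseteq> {real a / 2 ^ n..(real a + 1) / 2 ^ n}"
    proof
      fix t assume t: "t \<in> {t::real. 0 \<le> t \<and> t < 1 \<and> nat \<lfloor>2 ^ n * t\<rfloor> = a}"
      then have "\<lfloor>2 ^ n * t\<rfloor> = int a" by auto
      then have "real a \<le> 2 ^ n * t" "2 ^ n * t \<le> real a + 1"
        by linarith+
      then show "t \<in> {real a / 2 ^ n..(real a + 1) / 2 ^ n}"
        by (simp add: field_simps)
    qed
  qed simp
  also have "\<dots> = ennreal (1 / 2 ^ n)"
    by (simp add: divide_right_mono add_divide_distrib)
  finally show ?thesis .
qed

lemma emeasure_masked_prefix_fiber: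
  "emeasure lborel {t::real. 0 \<le> t \<and> t < 1 \<and> masked_prefix S n t = j} \<le> ennreal (2 ^ card (S \<inter> {..<n}) / 2 ^ n)"
proof -
  let ?A = "{a. a < 2 ^ n \<and> mask S n a = j}"
  have fin: "finite ?A"
    by (rule finite_subset[of _ "{..<2 ^ n}"]) auto
  have "{t::real. 0 \<le> t \<and> t < 1 \<and> masked_prefix S n t = j} \<subseteq> (\<Union>a\<in>?A. {t::real. 0 \<le> t \<and> t < 1 \<and> nat \<lfloor>2 ^ n * t\<rfloor> = a})"
  proof
    fix t assume t: "t \<in> {t::real. 0 \<le> t \<and> t < 1 \<and> masked_prefix S n t = j}"
    then have "2 ^ n * t < 2 ^ n" by simp
    then have "nat \<lfloor>2 ^ n * t\<rfloor> < 2 ^ n" by (simp add: nat_less_iff floor_less_iff)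
    then show "t \<in> (\<Union>a\<in>?A. {t::real. 0 \<le> t \<and> t < 1 \<and> nat \<lfloor>2 ^ n * t\<rfloor> = a})"
      using t by (auto simp: masked_prefix_def)
  qed
  then have "emeasure lborel {t::real. 0 \<le> t \<and> t < 1 \<and> masked_prefix S n t = j}
      \<le> emeasure lborel (\<Union>a\<in>?A. {t::real. 0 \<le> t \<and> t < 1 \<and> nat \<lfloor>2 ^ n * t\<rfloor> = a})"
    by (rule emeasure_mono) (intro sets.finite_UN fin, simp)
  also have "\<dots> \<le> (\<Sum>a\<in>?A. emeasure lborel {t::real. 0 \<le> t \<and> t < 1 \<and> nat \<lfloor>2 ^ n * t\<rfloor> = a})"
    by (rule emeasure_subadditive_finite[OF fin]) auto
  also have "\<dots> \<le> (\<Sum>a\<in>?A. ennreal (1 / 2 ^ n))"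
    by (intro sum_mono emeasure_floor_fiber)
  also have "\<dots> = ennreal (real (card ?A) / 2 ^ n)"
    by (simp add: ennreal_of_nat_eq_real_of_nat ennreal_mult[symmetric] del: ennreal_of_nat_eq_real_of_nat[symmetric])
  also have "\<dots> \<le> ennreal (2 ^ card (S \<inter> {..<n}) / 2 ^ n)"
  proof (intro ennreal_leI divide_right_mono)
    have "real (card ?A) \<le> real (2 ^ card (S \<inter> {..<n}))"
      by (simp only: of_nat_le_iff card_mask_fiber_le)
    then show "real (card ?A) \<le> 2 ^ card (S \<inter> {..<n})" by simp
  qed simp
  finally show ?thesis .
qed

lemma masked_digit_measure:
  assumes "infinite S"
  obtains \<mu> :: "real measure" where "prob_space \<mu>" "sets \<mu> = sets borel"
    "AE x in \<mu>. 0 \<le> x \<and> x < 1" "AE x in \<mu>. \<forall>s\<in>S. 0 \<le> sin (2 * pi * 2 ^ s * x)"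
    "\<And>n j. measure \<mu> {x. \<lfloor>2 ^ n * x\<rfloor> = int j} \<le> 2 ^ card (S \<inter> {..<n}) / 2 ^ n"
proof -
  define P where "P = uniform_measure lborel {0..<1::real}"
  define \<mu> where "\<mu> = distr P borel (masked_real S)"
  interpret P: prob_space P
    unfolding P_def by (rule prob_space_uniform_measure) auto
  have [measurable]: "masked_real S \<in> P \<rightarrow>\<^sub>M borel"
    unfolding P_def by (simp add: measurable_def)
      (use measurable_masked_real[of S] in \<open>simp add: measurable_def\<close>)
  have "prob_space \<mu>"
    unfolding \<mu>_def by (rule P.prob_space_distr) measurable
  moreover have "sets \<mu> = sets borel"
    by (simp add: \<mu>_def)
  moreover have "AE x in \<mu>. 0 \<le> x \<and> x < 1"
  proof -
    \<comment> \<open>At n = 0 the prefix is empty and equals 0, which places all values in [0,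
      1).\<close>
    have "\<lfloor>masked_real S t\<rfloor> = 0" for t
      using floor_masked_real[OF assms, of 0 t] by (simp add: masked_prefix_def)
    then have "0 \<le> masked_real S t \<and> masked_real S t < 1" for t
      by (simp add: floor_eq_iff)
    then show ?thesis
      unfolding \<mu>_def by (subst AE_distr_iff) auto
  qed
  moreover have "AE x in \<mu>. \<forall>s\<in>S. 0 \<le> sin (2 * pi * 2 ^ s * x)"
  proof -
    have sin: "0 \<le> sin (2 * pi * 2 ^ s * masked_real S t)" if "s \<in> S" for s t
    proof -
      let ?p = "masked_prefix S s t" and ?y = "2 ^ s * masked_real S t"
      \<comment> \<open>Removing full periods leaves an angle in [0, pi].\<close>
      have eq: "2 * pi * 2 ^ s * masked_real S t = 2 * pi * (?y - real ?p) + 2 * real ?p * pi"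
        by (simp add: algebra_simps)
      have "0 \<le> sin (2 * pi * (?y - real ?p))"
      proof (rule sin_ge_zero)
        show "0 \<le> 2 * pi * (?y - real ?p)"
          using masked_real_erased_digit(1)[OF that, of t] by simp
        have "2 * pi * (?y - real ?p) \<le> 2 * pi * (1 / 2)"
          using masked_real_erased_digit(2)[OF that, of t] by (intro mult_left_mono) auto
        then show "2 * pi * (?y - real ?p) \<le> pi" by simp
      qed
      then show ?thesis
        unfolding eq sin_add sin_2npi cos_2npi by simp
    qed
    have [measurable]: "{x. \<forall>s\<in>S. 0 \<le> sin (2 * pi * 2 ^ s * x)} \<in> sets borel"
      unfolding Collect_ball_eq by (intro borel_closed closed_INT ballI closed_Collect_le continuous_intros)
    show ?thesis
      unfolding \<mu>_def by (subst AE_distr_iff) (use sin in auto)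
  qed
  moreover have "measure \<mu> {x. \<lfloor>2 ^ n * x\<rfloor> = int j} \<le> 2 ^ card (S \<inter> {..<n}) / 2 ^ n" for n j
  proof -
    have "emeasure \<mu> {x. \<lfloor>2 ^ n * x\<rfloor> = int j} = emeasure P (masked_real S -` {x. \<lfloor>2 ^ n * x\<rfloor> = int j} \<inter> space P)"
      unfolding \<mu>_def by (rule emeasure_distr) auto
    also have "masked_real S -` {x. \<lfloor>2 ^ n * x\<rfloor> = int j} \<inter> space P = {t. masked_prefix S n t = j}"
      using floor_masked_real[OF assms] by (auto simp: P_def)
    also have "emeasure P {t. masked_prefix S n t = j} = emeasure lborel ({0..<1} \<inter> {t. masked_prefix S n t = j})"
      unfolding P_def by (subst emeasure_uniform_measure) (auto simp: divide_ennreal_def)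
    also have "{0..<1} \<inter> {t. masked_prefix S n t = j} = {t::real. 0 \<le> t \<and> t < 1 \<and> masked_prefix S n t = j}"
      by auto
    also have "emeasure lborel \<dots> \<le> ennreal (2 ^ card (S \<inter> {..<n}) / 2 ^ n)"
      by (rule emeasure_masked_prefix_fiber)
    finally show ?thesis
      unfolding measure_def by (rule enn2real_leI[rotated]) simp
  qed
  ultimately show ?thesis using that by blast
qed

lemma measure_Icc_le_two_cells:
  fixes \<mu> :: "real measure"
  assumes "prob_space \<mu>" "sets \<mu> = sets borel" and AE: "AE x in \<mu>. 0 \<le> x \<and> x < 1"
    and cell: "\<And>j. measure \<mu> {x. \<lfloor>2 ^ n * x\<rfloor> = int j} \<le> \<eta>"
    and "y - x \<le> 1 / 2 ^ n"
  shows "measure \<mu> {x..y} \<le> 2 * \<eta>"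
proof -
  interpret prob_space \<mu> by fact
  note [measurable_cong] = \<open>sets \<mu> = sets borel\<close>
  \<comment> \<open>The truncation by \<open>nat\<close> matters only for negative x: then j = 0,
    and the nonnegative part of the interval lies in cell 0.\<close>
  define j where "j = nat \<lfloor>2 ^ n * x\<rfloor>"
  define c where "c i = {x::real. \<lfloor>2 ^ n * x\<rfloor> = int i}" for i
  have [measurable]: "c i \<in> sets \<mu>" for i
    unfolding c_def \<open>sets \<mu> = sets borel\<close> by measurable
  have mem: "z \<in> c j \<union> c (Suc j)" if z: "z \<in> {x..y}" "0 \<le> z" for z
  proof -
    have "2 ^ n * z \<le> 2 ^ n * (x + 1 / 2 ^ n)"
      using z assms(5) by (intro mult_left_mono) auto
    then have "2 ^ n * z \<le> 2 ^ n * x + 1"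
      by (simp add: algebra_simps)
    moreover have "2 ^ n * x \<le> 2 ^ n * z"
      using z by simp
    moreover have "0 \<le> 2 ^ n * z"
      using z by simp
    ultimately have "0 \<le> \<lfloor>2 ^ n * z\<rfloor>" "\<lfloor>2 ^ n * x\<rfloor> \<le> \<lfloor>2 ^ n * z\<rfloor>" "\<lfloor>2 ^ n * z\<rfloor> \<le> \<lfloor>2 ^ n * x\<rfloor> + 1"
      by linarith+
    then have "\<lfloor>2 ^ n * z\<rfloor> = int (nat \<lfloor>2 ^ n * x\<rfloor>) \<or> \<lfloor>2 ^ n * z\<rfloor> = int (Suc (nat \<lfloor>2 ^ n * x\<rfloor>))"
      by (cases "0 \<le> \<lfloor>2 ^ n * x\<rfloor>") (simp_all, linarith+)
    then show ?thesis
      unfolding c_def j_def by blast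
  qed
  have "AE z in \<mu>. z \<in> {x..y} \<longrightarrow> z \<in> c j \<union> c (Suc j)"
    using AE by eventually_elim (use mem in blast)
  then have "measure \<mu> {x..y} \<le> measure \<mu> (c j \<union> c (Suc j))"
    by (rule finite_measure_mono_AE) measurable
  also have "\<dots> \<le> measure \<mu> (c j) + measure \<mu> (c (Suc j))"
    by (rule measure_Un_le) measurable
  also have "\<dots> \<le> 2 * \<eta>"
    using cell[of j] cell[of "Suc j"] by (simp add: c_def)
  finally show ?thesis .
qed

section \<open>Digit frequencies\<close>

text \<open>\<open>digit_dev b m u L k a\<close> tests whether the block of \<open>m\<close> digits after the \<open>k\<close> leading ones of the
  \<open>L\<close>-digit number \<open>a\<close> in base \<open>b\<close> is less than \<open>u\<close>, centred at the expected value.\<close>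

definition digit_dev :: "nat \<Rightarrow> nat \<Rightarrow> nat \<Rightarrow> nat \<Rightarrow> nat \<Rightarrow> nat \<Rightarrow> real" where
  "digit_dev b m u L k a =
     (if (a div b ^ (L - k - m)) mod b ^ m < u then 1 else 0) - real u / real (b ^ m)"

text \<open>As r runs through a full period, the digit block equals \<open>r div c\<close> and takes
  each of its \<open>b ^ m\<close> values exactly c times, so the centred indicator sums to
  0.\<close>

lemma sum_residues_digit_dev:
  fixes b c m u q :: nat
  assumes "b > 0" "c > 0" "u \<le> b ^ m"
  shows "(\<Sum>r<c * b ^ m. (if ((q * (c * b ^ m) + r) div c) mod b ^ m < u then 1 else 0) - real u / real (b ^ m)) = 0"
proof -
  have "((q * (c * b ^ m) + r) div c) mod b ^ m < u \<longleftrightarrow> r < u * c" if "r < c * b ^ m" for r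
  proof -
    have "q * (c * b ^ m) + r = c * (q * b ^ m) + r" by (simp add: mult_ac)
    then have "(q * (c * b ^ m) + r) div c = q * b ^ m + r div c"
      using \<open>c > 0\<close> by (simp only: div_mult_self4)
    moreover have "r div c < b ^ m"
      using that by (simp add: less_mult_imp_div_less mult.commute)
    ultimately have "((q * (c * b ^ m) + r) div c) mod b ^ m = r div c"
      by simp
    then show ?thesis
      using \<open>c > 0\<close> by (simp add: div_less_iff_less_mult)
  qed
  then have "(\<Sum>r<c * b ^ m. (if ((q * (c * b ^ m) + r) div c) mod b ^ m < u then 1 else 0) - real u / real (b ^ m))
      = (\<Sum>r<c * b ^ m. (if r < u * c then 1 else 0) - real u / real (b ^ m))"
    by (intro sum.cong) auto
  also have "\<dots> = real (card {r \<in> {..<c * b ^ m}. r < u * c}) - real (c * b ^ m) * (real u / real (b ^ m))"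
    by (simp add: sum_subtractf sum.If_cases Int_def)
  also have "{r \<in> {..<c * b ^ m}. r < u * c} = {..<u * c}"
    using assms(3) by (auto simp: mult.commute intro: less_le_trans)
  finally show ?thesis
    using \<open>b > 0\<close> by simp
qed

text \<open>Disjoint digit blocks are uncorrelated under the counting measure: fixing the leading l
  digits, the quotient q, freezes the earlier block, while the later block still runs through a full
  period and averages to 0.\<close>

lemma sum_digit_dev_product:
  assumes "b > 0" "u \<le> b ^ m" "k + m \<le> l" "l + m \<le> L"
  shows "(\<Sum>a<b ^ L. digit_dev b m u L k a * digit_dev b m u L l a) = 0"
proof -
  define c where "c = b ^ (L - l - m)"
  define P where "P = c * b ^ m"
  have "c > 0" "P > 0" using \<open>b > 0\<close> by (simp_all add: c_def P_def)
  have P: "P = b ^ (L - l)"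
    using assms by (simp add: P_def c_def power_add[symmetric])
  have bL: "b ^ L = b ^ l * P"
    using assms by (simp add: P power_add[symmetric])
  define G where "G q = (if (q div b ^ (l - k - m)) mod b ^ m < u then 1 else 0) - real u / real (b ^ m)" for q
  have 1: "digit_dev b m u L k a = G (a div P)" for a
  proof -
    have "b ^ (L - k - m) = P * b ^ (l - k - m)"
      using assms by (simp add: P power_add[symmetric])
    then show ?thesis by (simp add: digit_dev_def G_def div_mult2_eq)
  qed
  have "(\<Sum>a<b ^ L. digit_dev b m u L k a * digit_dev b m u L l a)
      = (\<Sum>q<b ^ l. \<Sum>a=q*P..<q*P+P. digit_dev b m u L k a * digit_dev b m u L l a)"
    unfolding bL by (rule sum.nat_group[symmetric])
  also have "\<dots> = (\<Sum>q<b ^ l. 0)"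
  proof (rule sum.cong[OF refl])
    fix q
    have "(\<Sum>a=q*P..<q*P+P. digit_dev b m u L k a * digit_dev b m u L l a)
        = (\<Sum>a=q*P..<q*P+P. G q * digit_dev b m u L l a)"
    proof (rule sum.cong[OF refl])
      fix a assume "a \<in> {q*P..<q*P+P}"
      then have "a div P = q"
        by (auto intro!: div_nat_eqI simp: mult.commute algebra_simps)
      then show "digit_dev b m u L k a * digit_dev b m u L l a = G q * digit_dev b m u L l a"
        by (simp add: 1)
    qed
    also have "\<dots> = G q * (\<Sum>a=q*P..<q*P+P. digit_dev b m u L l a)"
      by (simp add: sum_distrib_left)
    also have "(\<Sum>a=q*P..<q*P+P. digit_dev b m u L l a) = (\<Sum>r<P. digit_dev b m u L l (q * P + r))"
      using sum.atLeastLessThan_shift_0[of "digit_dev b m u L l" "q * P" "q * P + P"]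
      by (simp add: atLeast0LessThan add.commute comp_def)
    also have "\<dots> = 0"
      unfolding digit_dev_def P_def c_def[symmetric]
      by (rule sum_residues_digit_dev) (use assms \<open>c > 0\<close> in auto)
    finally show "(\<Sum>a=q*P..<q*P+P. digit_dev b m u L k a * digit_dev b m u L l a) = 0" by simp
  qed
  finally show ?thesis by simp
qed

lemma abs_digit_dev_le_1: "u \<le> b ^ m \<Longrightarrow> \<bar>digit_dev b m u L k a\<bar> \<le> 1"
proof -
  assume "u \<le> b ^ m"
  then have "real u \<le> real (b ^ m)" by (simp only: of_nat_le_iff)
  then have "real u / real (b ^ m) \<le> 1" by (auto simp: divide_le_eq_1)
  moreover have "0 \<le> real u / real (b ^ m)" by simp
  ultimately show ?thesis
    unfolding digit_dev_def by (auto simp only: abs_le_iff split: if_splits)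
qed

text \<open>Only pairs of positions at distance at most m contribute; for each k at most 2 m of them
  are counted, with products bounded by 1.\<close>

lemma second_moment_digit_dev:
  assumes "b > 0" "u \<le> b ^ m" "N + m \<le> L"
  shows "(\<Sum>a<b ^ L. (\<Sum>k=1..N. digit_dev b m u L k a)\<^sup>2) \<le> real (b ^ L) * (2 * real m * real N)"
proof -
  let ?g = "digit_dev b m u L"
  have bound: "(\<Sum>a<b ^ L. ?g k a * ?g l a) \<le> (if l \<in> {k - m..<k + m} then real (b ^ L) else 0)"
    if "k \<in> {1..N}" "l \<in> {1..N}" for k l
  proof (cases "l \<in> {k - m..<k + m}")
    case True
    have "(\<Sum>a<b ^ L. ?g k a * ?g l a) \<le> (\<Sum>a<b ^ L. 1)"
    proof (rule sum_mono)
      fix a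
      have "\<bar>?g k a * ?g l a\<bar> \<le> 1 * 1"
        unfolding abs_mult using assms by (intro mult_mono abs_digit_dev_le_1) auto
      then show "?g k a * ?g l a \<le> 1" by linarith
    qed
    then show ?thesis using True by simp
  next
    case False
    then consider "l + m \<le> k" | "k + m \<le> l" by fastforce
    then have "(\<Sum>a<b ^ L. ?g k a * ?g l a) = 0"
    proof cases
      case 1
      then have "(\<Sum>a<b ^ L. ?g l a * ?g k a) = 0"
        using assms that by (intro sum_digit_dev_product) auto
      then show ?thesis by (simp add: mult.commute)
    next
      case 2
      then show ?thesis
        using assms that by (intro sum_digit_dev_product) auto
    qed
    then show ?thesis using False by simp
  qed
  have "(\<Sum>a<b ^ L. (\<Sum>k=1..N. ?g k a)\<^sup>2) = (\<Sum>a<b ^ L. \<Sum>k=1..N. \<Sum>l=1..N. ?g k a * ?g l a)"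
    by (simp add: power2_eq_square sum_product)
  also have "\<dots> = (\<Sum>k=1..N. \<Sum>a<b ^ L. \<Sum>l=1..N. ?g k a * ?g l a)"
    by (rule sum.swap)
  also have "\<dots> = (\<Sum>k=1..N. \<Sum>l=1..N. \<Sum>a<b ^ L. ?g k a * ?g l a)"
    by (intro sum.cong refl sum.swap)
  also have "\<dots> \<le> (\<Sum>k=1..N. \<Sum>l=1..N. if l \<in> {k - m..<k + m} then real (b ^ L) else 0)"
    by (intro sum_mono bound)
  also have "\<dots> \<le> (\<Sum>k=1..N. 2 * real m * real (b ^ L))"
  proof (rule sum_mono)
    fix k
    have "card ({1..N} \<inter> {k - m..<k + m}) \<le> card {k - m..<k + m}"
      by (intro card_mono) auto
    also have "\<dots> \<le> 2 * m" by simp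
    finally have "real (card ({1..N} \<inter> {k - m..<k + m})) \<le> 2 * real m"
      by linarith
    then show "(\<Sum>l=1..N. if l \<in> {k - m..<k + m} then real (b ^ L) else 0) \<le> 2 * real m * real (b ^ L)"
      by (subst sum.inter_restrict[symmetric]) (auto intro!: mult_right_mono)
  qed
  finally show ?thesis by (simp add: mult_ac)
qed

text \<open>Chebyshev's inequality for the counting measure. As a count of integers it transfers to
  every measure for which the mass of base b cells is bounded.\<close>

lemma card_large_digit_dev:
  assumes "b > 0" "u \<le> b ^ m" "N + m \<le> L" "\<epsilon> > 0" "N > 0"
  shows "real (card {a. a < b ^ L \<and> \<epsilon> * real N \<le> \<bar>\<Sum>k=1..N. digit_dev b m u L k a\<bar>})
     \<le> real (b ^ L) * (2 * real m / (\<epsilon>\<^sup>2 * real N))"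
proof -
  let ?S = "\<lambda>a. \<Sum>k=1..N. digit_dev b m u L k a"
  let ?B = "{a. a < b ^ L \<and> \<epsilon> * real N \<le> \<bar>?S a\<bar>}"
  have "real (card ?B) * (\<epsilon> * real N)\<^sup>2 = (\<Sum>a\<in>?B. (\<epsilon> * real N)\<^sup>2)" by simp
  also have "\<dots> \<le> (\<Sum>a\<in>?B. (?S a)\<^sup>2)"
  proof (rule sum_mono)
    fix a assume "a \<in> ?B"
    then have "(\<epsilon> * real N)\<^sup>2 \<le> \<bar>?S a\<bar>\<^sup>2"
      using assms by (intro power_mono) auto
    then show "(\<epsilon> * real N)\<^sup>2 \<le> (?S a)\<^sup>2" by simp
  qed
  also have "\<dots> \<le> (\<Sum>a<b ^ L. (?S a)\<^sup>2)"
    by (intro sum_mono2) auto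
  also have "\<dots> \<le> real (b ^ L) * (2 * real m * real N)"
    by (rule second_moment_digit_dev) fact+
  finally have "real (card ?B) * (\<epsilon> * real N)\<^sup>2 \<le> real (b ^ L) * (2 * real m * real N)" .
  then have "real (card ?B) \<le> real (b ^ L) * (2 * real m * real N) / (\<epsilon> * real N)\<^sup>2"
    using assms by (simp add: pos_le_divide_eq)
  also have "\<dots> = real (b ^ L) * (2 * real m / (\<epsilon>\<^sup>2 * real N))"
    using assms by (simp add: power2_eq_square field_simps)
  finally show ?thesis .
qed

section \<open>From digit blocks to equidistribution\<close>

definition count_below :: "(nat \<Rightarrow> real) \<Rightarrow> real \<Rightarrow> nat \<Rightarrow> nat" where
  "count_below y t N = card {k \<in> {1..N}. y k < t}"

lemma count_below_mono: "s \<le> t \<Longrightarrow> M \<le> N \<Longrightarrow> count_below y s M \<le> count_below y t N"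
  unfolding count_below_def by (intro card_mono) auto

text \<open>Since u is an integer, the comparison with an adic threshold may be made after rounding
  down, and so depends only on the first m digits of the fractional part. These form a block of the
  truncation of x to L digits.\<close>

lemma frac_less_iff_digit_block:
  fixes b k m L u :: nat and x :: real
  assumes "b > 0" "x \<ge> 0" "k + m \<le> L"
  shows "frac (real b ^ k * x) < real u / real (b ^ m)
     \<longleftrightarrow> (nat \<lfloor>real b ^ L * x\<rfloor> div b ^ (L - k - m)) mod b ^ m < u"
proof -
  define y where "y = real b ^ k * x"
  have bm: "real (b ^ m) > 0" using \<open>b > 0\<close> by simp
  have "\<lfloor>real b ^ L * x / real_of_int (int (b ^ (L - k - m)))\<rfloor> = \<lfloor>real b ^ L * x\<rfloor> div int (b ^ (L - k - m))"
    by (rule floor_divide_real_eq_div) simp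
  moreover have "real b ^ L * x / real_of_int (int (b ^ (L - k - m))) = real (b ^ m) * y"
  proof -
    have "real b ^ L = real b ^ (L - k - m) * (real b ^ m * real b ^ k)"
      using assms(3) by (simp add: power_add[symmetric])
    then show ?thesis using \<open>b > 0\<close> by (simp add: y_def)
  qed
  ultimately have eq: "\<lfloor>real (b ^ m) * y\<rfloor> = \<lfloor>real b ^ L * x\<rfloor> div int (b ^ (L - k - m))"
    by simp
  have "real (b ^ m) * y = real (b ^ m) * frac y + of_int (int (b ^ m) * \<lfloor>y\<rfloor>)"
    by (simp add: frac_def algebra_simps)
  then have "\<lfloor>real (b ^ m) * y\<rfloor> = \<lfloor>real (b ^ m) * frac y\<rfloor> + int (b ^ m) * \<lfloor>y\<rfloor>"
    by (simp only: floor_add_int)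
  moreover have "0 \<le> \<lfloor>real (b ^ m) * frac y\<rfloor>"
    by simp
  moreover have "real (b ^ m) * frac y < real (b ^ m) * 1"
    using frac_lt_1[of y] bm by (intro mult_strict_left_mono)
  then have "\<lfloor>real (b ^ m) * frac y\<rfloor> < int (b ^ m)"
    by (simp add: floor_less_iff)
  ultimately have mod: "\<lfloor>real (b ^ m) * y\<rfloor> mod int (b ^ m) = \<lfloor>real (b ^ m) * frac y\<rfloor>"
    by simp
  have "frac y < real u / real (b ^ m) \<longleftrightarrow> real (b ^ m) * frac y < real u"
    using bm by (simp add: pos_less_divide_eq mult.commute)
  also have "\<dots> \<longleftrightarrow> \<lfloor>real (b ^ m) * frac y\<rfloor> < int u"
    by (simp add: floor_less_iff)
  also have "\<dots> \<longleftrightarrow> (\<lfloor>real b ^ L * x\<rfloor> div int (b ^ (L - k - m))) mod int (b ^ m) < int u"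
    by (simp only: mod[symmetric] eq)
  also have "\<lfloor>real b ^ L * x\<rfloor> = int (nat \<lfloor>real b ^ L * x\<rfloor>)"
    using assms by simp
  finally show ?thesis
    unfolding y_def by (simp only: zdiv_int[symmetric] zmod_int[symmetric] of_nat_less_iff)
qed

lemma sum_digit_dev_eq_count:
  fixes b m L u N :: nat and x :: real
  assumes "b > 0" "x \<ge> 0" "N + m \<le> L"
  shows "(\<Sum>k=1..N. digit_dev b m u L k (nat \<lfloor>real b ^ L * x\<rfloor>)) =
    real (count_below (\<lambda>k. frac (real b ^ k * x)) (real u / real (b ^ m)) N) - real N * (real u / real (b ^ m))"
proof -
  have "(\<Sum>k=1..N. digit_dev b m u L k (nat \<lfloor>real b ^ L * x\<rfloor>)) =
     (\<Sum>k=1..N. (if frac (real b ^ k * x) < real u / real (b ^ m) then 1 else 0) - real u / real (b ^ m))"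
    unfolding digit_dev_def using assms by (intro sum.cong refl) (subst frac_less_iff_digit_block, auto)
  also have "\<dots> = real (count_below (\<lambda>k. frac (real b ^ k * x)) (real u / real (b ^ m)) N) - real N * (real u / real (b ^ m))"
    by (simp add: sum_subtractf sum.If_cases Int_def count_below_def)
  finally show ?thesis .
qed

text \<open>A monotone count at N lies between its values at the neighbouring fourth powers, whose
  ratio tends to 1.\<close>

lemma tendsto_ratio_interpolate:
  fixes c :: "nat \<Rightarrow> nat"
  assumes "mono c" and lim: "(\<lambda>M. real (c (M ^ 4)) / real (M ^ 4)) \<longlonglongrightarrow> t"
  shows "(\<lambda>N. real (c N) / real N) \<longlonglongrightarrow> t"
proof -
  define M where "M N = nat \<lfloor>root 4 (real N)\<rfloor>" for N
  have M_le: "real (M N) \<le> root 4 (real N)" and less_M: "root 4 (real N) < real (M N + 1)" for N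
    using real_root_ge_zero[of "real N" 4] unfolding M_def by simp_all linarith+
  have M4: "M N ^ 4 \<le> N" "N < (M N + 1) ^ 4" for N
  proof -
    have "real (M N) ^ 4 \<le> root 4 (real N) ^ 4"
      by (intro power_mono M_le) simp
    then have "real (M N ^ 4) \<le> real N" by simp
    then show "M N ^ 4 \<le> N" by (simp only: of_nat_le_iff)
    have "root 4 (real N) ^ 4 < real (M N + 1) ^ 4"
      by (intro power_strict_mono less_M) auto
    then have "real N < real ((M N + 1) ^ 4)" by simp
    then show "N < (M N + 1) ^ 4" by (simp only: of_nat_less_iff)
  qed
  have M_top: "filterlim M at_top sequentially"
    unfolding filterlim_at_top
  proof
    fix Z
    have "Z \<le> M N" if "N \<ge> Z ^ 4" for N
    proof -
      have "Z ^ 4 < (M N + 1) ^ 4" using that M4(2)[of N] by linarith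
      then show ?thesis
        using power_less_imp_less_base[of Z 4 "M N + 1"] by simp
    qed
    then show "\<forall>\<^sub>F N in sequentially. Z \<le> M N"
      unfolding eventually_sequentially by blast
  qed
  have "(\<lambda>m. real (c (m ^ 4)) / real (m ^ 4) * (real m / (real m + 1)) ^ 4) \<longlonglongrightarrow> t * 1"
    by (intro tendsto_mult lim) real_asymp
  from filterlim_compose[OF this M_top]
  have low: "(\<lambda>N. real (c (M N ^ 4)) / real (M N ^ 4) * (real (M N) / (real (M N) + 1)) ^ 4) \<longlonglongrightarrow> t" by simp
  have "(\<lambda>m. real (c (Suc m ^ 4)) / real (Suc m ^ 4) * ((real m + 1) / real m) ^ 4) \<longlonglongrightarrow> t * 1"
    by (intro tendsto_mult LIMSEQ_Suc[OF lim]) real_asymp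
  from filterlim_compose[OF this M_top]
  have up: "(\<lambda>N. real (c (Suc (M N) ^ 4)) / real (Suc (M N) ^ 4) * ((real (M N) + 1) / real (M N)) ^ 4) \<longlonglongrightarrow> t" by simp
  have pos: "\<forall>\<^sub>F N in sequentially. 1 \<le> M N"
    using M_top by (simp add: filterlim_at_top)
  show ?thesis
  proof (rule tendsto_sandwich[OF _ _ low up])
    show "\<forall>\<^sub>F N in sequentially. real (c (M N ^ 4)) / real (M N ^ 4) * (real (M N) / (real (M N) + 1)) ^ 4 \<le> real (c N) / real N"
      using pos
    proof eventually_elim
      fix N assume "1 \<le> M N"
      then have N: "N > 0" using M4(1)[of N] by (cases N) auto
      have "real (c (M N ^ 4)) / real (M N ^ 4) * (real (M N) / (real (M N) + 1)) ^ 4 = real (c (M N ^ 4)) / real ((M N + 1) ^ 4)"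
        using \<open>1 \<le> M N\<close> by (simp add: power_divide add.commute)
      also have "\<dots> \<le> real (c N) / real N"
        using M4[of N] N monoD[OF \<open>mono c\<close> M4(1)[of N]] by (intro frac_le) (simp_all only: of_nat_le_iff of_nat_0_less_iff of_nat_0_le_iff less_imp_le)
      finally show "real (c (M N ^ 4)) / real (M N ^ 4) * (real (M N) / (real (M N) + 1)) ^ 4 \<le> real (c N) / real N" .
    qed
    show "\<forall>\<^sub>F N in sequentially. real (c N) / real N \<le> real (c (Suc (M N) ^ 4)) / real (Suc (M N) ^ 4) * ((real (M N) + 1) / real (M N)) ^ 4"
      using pos
    proof eventually_elim
      fix N assume M1: "1 \<le> M N"
      have le: "N \<le> Suc (M N) ^ 4" using M4(2)[of N] by simp
      have "0 < M N ^ 4" using M1 by simp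
      then have "real (c N) / real N \<le> real (c (Suc (M N) ^ 4)) / real (M N ^ 4)"
        using M4[of N] monoD[OF \<open>mono c\<close> le] by (intro frac_le) (simp_all only: of_nat_le_iff of_nat_0_less_iff of_nat_0_le_iff)
      also have "\<dots> = real (c (Suc (M N) ^ 4)) / real (Suc (M N) ^ 4) * ((real (M N) + 1) / real (M N)) ^ 4"
        using M1 by (simp add: power_divide add.commute)
      finally show "real (c N) / real N \<le> real (c (Suc (M N) ^ 4)) / real (Suc (M N) ^ 4) * ((real (M N) + 1) / real (M N)) ^ 4" .
    qed
  qed
qed

text \<open>A threshold t is squeezed between neighbouring fractions with denominator
  \<open>b ^ m\<close>, and counts over intervals are differences of counts below
  thresholds.\<close>

lemma equidistributed_if_adic_frequencies:
  assumes "b \<ge> 2"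
    and freq: "\<And>m u. m \<ge> 1 \<Longrightarrow> u \<le> b ^ m \<Longrightarrow>
      (\<lambda>N. real (count_below y (real u / real (b ^ m)) N) / real N) \<longlonglongrightarrow> real u / real (b ^ m)"
  shows "equidistributed_unit_interval y"
proof -
  have below: "(\<lambda>N. real (count_below y t N) / real N) \<longlonglongrightarrow> t" if t: "0 \<le> t" "t \<le> 1" for t
  proof (rule LIMSEQ_I)
    fix r :: real assume "r > 0"
    have "(\<lambda>m. (1 / real b) ^ m) \<longlonglongrightarrow> 0"
      using \<open>b \<ge> 2\<close> by (intro LIMSEQ_power_zero) auto
    then have "\<forall>\<^sub>F m in sequentially. (1 / real b) ^ m < r / 2"
      by (rule order_tendstoD) (use \<open>r > 0\<close> in simp)
    then have "\<forall>\<^sub>F m in sequentially. (1 / real b) ^ m < r / 2 \<and> m \<ge> 1"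
      by (intro eventually_conj eventually_ge_at_top)
    then obtain m where m: "(1 / real b) ^ m < r / 2" "m \<ge> 1"
      using eventually_happens' sequentially_bot by blast
    define B where "B = real (b ^ m)"
    have B: "B > 0" "1 / B < r / 2" using m \<open>b \<ge> 2\<close> by (simp_all add: B_def power_divide)
    define u where "u = nat \<lfloor>t * B\<rfloor>"
    \<comment> \<open>The minimum keeps v admissible for \<open>freq\<close> when t = 1, where u is
      already \<open>b ^ m\<close>.\<close>
    define v where "v = min (u + 1) (b ^ m)"
    have u: "real u \<le> t * B" "t * B < real u + 1"
      using t B by (simp_all add: u_def)
    have uB: "u \<le> b ^ m"
    proof -
      have "t * B \<le> 1 * B" using t B by (intro mult_right_mono) auto
      then have "real u \<le> real (b ^ m)" using u unfolding B_def by linarith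
      then show ?thesis by (simp only: of_nat_le_iff)
    qed
    have ut: "real u / B \<le> t" "t < real u / B + r / 2"
    proof -
      show "real u / B \<le> t" using u B by (simp add: pos_divide_le_eq)
      have "t < (real u + 1) / B" using u B by (simp add: pos_less_divide_eq)
      then show "t < real u / B + r / 2" using B by (simp add: add_divide_distrib)
    qed
    have vt: "t \<le> real v / B" "real v / B < t + r / 2"
    proof -
      have "t * B \<le> real v"
      proof (cases "u + 1 \<le> b ^ m")
        case True
        then show ?thesis using u(2) by (simp add: v_def)
      next
        case False
        then have "real v = B" by (simp add: v_def B_def min_def)
        then show ?thesis using mult_right_mono[of t 1 B] t B by simp
      qed
      then show "t \<le> real v / B" using B by (simp add: pos_le_divide_eq)
      have "real v \<le> real u + 1" by (simp add: v_def)
      then have "real v / B \<le> (real u + 1) / B" using B by (intro divide_right_mono) auto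
      then show "real v / B < t + r / 2" using B ut(1) by (simp add: add_divide_distrib)
    qed
    have "\<forall>\<^sub>F N in sequentially. real (count_below y (real u / B) N) / real N > real u / B - r / 2"
      using freq[OF m(2) uB] \<open>r > 0\<close> unfolding B_def by (intro order_tendstoD(1)) auto
    moreover have "\<forall>\<^sub>F N in sequentially. real (count_below y (real v / B) N) / real N < real v / B + r / 2"
      using freq[OF m(2), of v] \<open>r > 0\<close> unfolding B_def by (intro order_tendstoD(2)) (auto simp: v_def)
    ultimately have "\<forall>\<^sub>F N in sequentially. norm (real (count_below y t N) / real N - t) < r"
    proof eventually_elim
      fix N
      assume 1: "real (count_below y (real u / B) N) / real N > real u / B - r / 2"
        "real (count_below y (real v / B) N) / real N < real v / B + r / 2"
      have "real (count_below y (real u / B) N) / real N \<le> real (count_below y t N) / real N"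
        using ut by (intro divide_right_mono of_nat_mono count_below_mono) auto
      moreover have "real (count_below y t N) / real N \<le> real (count_below y (real v / B) N) / real N"
        using vt by (intro divide_right_mono of_nat_mono count_below_mono) auto
      ultimately show "norm (real (count_below y t N) / real N - t) < r"
        using 1 ut vt unfolding real_norm_def abs_less_iff by linarith
    qed
    then show "\<exists>no. \<forall>N\<ge>no. norm (real (count_below y t N) / real N - t) < r"
      unfolding eventually_sequentially .
  qed
  show ?thesis
    unfolding equidistributed_unit_interval_def
  proof (intro allI impI)
    fix \<alpha> \<beta> :: real assume ab: "0 \<le> \<alpha> \<and> \<alpha> < \<beta> \<and> \<beta> \<le> 1"
    have split: "card {k \<in> {1..N}. y k \<in> {\<alpha>..<\<beta>}} + count_below y \<alpha> N = count_below y \<beta> N" for N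
    proof -
      have "{k \<in> {1..N}. y k < \<beta>} = {k \<in> {1..N}. y k \<in> {\<alpha>..<\<beta>}} \<union> {k \<in> {1..N}. y k < \<alpha>}"
        using ab by auto
      then show ?thesis
        unfolding count_below_def by (subst card_Un_disjoint[symmetric]) auto
    qed
    have "real (card {k \<in> {1..N}. y k \<in> {\<alpha>..<\<beta>}}) / real N =
        real (count_below y \<beta> N) / real N - real (count_below y \<alpha> N) / real N" for N
      unfolding split[symmetric] by (simp add: add_divide_distrib)
    moreover have "(\<lambda>N. real (count_below y \<beta> N) / real N - real (count_below y \<alpha> N) / real N) \<longlonglongrightarrow> \<beta> - \<alpha>"
      using ab by (intro tendsto_diff below) auto
    ultimately show "(\<lambda>N. real (card {k \<in> {1..N}. y k \<in> {\<alpha>..<\<beta>}}) / real N) \<longlonglongrightarrow> measure lborel {\<alpha>..<\<beta>}"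
      using ab by simp
  qed
qed

text \<open>The bound \<open>cell\<close> exceeds the Lebesgue measure of a cell by a factor of
  order sqrt L at most, which Chebyshev's gain 1 / N outweighs along fourth powers.\<close>

lemma AE_normal_in_base:
  fixes \<mu> :: "real measure"
  assumes "prob_space \<mu>" and sets_eq: "sets \<mu> = sets borel" and AE: "AE x in \<mu>. 0 \<le> x \<and> x < 1"
    and "b \<ge> 2"
    and cell: "\<And>L a. measure \<mu> {x. \<lfloor>real b ^ L * x\<rfloor> = int a} \<le> A * sqrt (real L + 1) / real (b ^ L)"
  shows "AE x in \<mu>. normal_in_base b x"
proof -
  interpret prob_space \<mu> by fact
  note [measurable_cong] = sets_eq
  have "b > 0" using \<open>b \<ge> 2\<close> by simp
  have "0 \<le> A"
    using order_trans[OF measure_nonneg cell[of 0 0]] by simp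
  define D where "D m u N x = \<bar>real (count_below (\<lambda>k. frac (real b ^ k * x)) (real u / real (b ^ m)) N)
      - real N * (real u / real (b ^ m))\<bar>" for m u N x
  have [measurable]: "D m u N \<in> borel_measurable borel" for m u N
  proof -
    have "real (count_below (\<lambda>k. frac (real b ^ k * x)) t N) =
        (\<Sum>k=1..N. if real b ^ k * x - of_int \<lfloor>real b ^ k * x\<rfloor> < t then 1 else 0)" for x t
      by (simp add: count_below_def frac_def sum.If_cases Int_def)
    then show ?thesis
      unfolding D_def[abs_def] by simp
  qed
  \<comment> \<open>Tolerances are restricted to 1 / (i + 1), so that countably many null sets
    suffice.\<close>
  have "AE x in \<mu>. \<forall>m u i. 1 \<le> m \<and> u \<le> b ^ m \<longrightarrow>
      (\<forall>\<^sub>F M in sequentially. D m u (Suc M ^ 4) x < real (Suc M ^ 4) / real (Suc i))"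
    unfolding AE_all_countable
  proof (intro allI)
    fix m u i
    show "AE x in \<mu>. 1 \<le> m \<and> u \<le> b ^ m \<longrightarrow>
      (\<forall>\<^sub>F M in sequentially. D m u (Suc M ^ 4) x < real (Suc M ^ 4) / real (Suc i))"
    proof (cases "1 \<le> m \<and> u \<le> b ^ m")
      case True
      define \<epsilon> where "\<epsilon> = 1 / real (Suc i)"
      have "\<epsilon> > 0" by (simp add: \<epsilon>_def)
      define E where "E M = {x. \<epsilon> * real (Suc M ^ 4) \<le> D m u (Suc M ^ 4) x}" for M
      have E_sets [measurable]: "E M \<in> sets \<mu>" for M
        unfolding E_def sets_eq by measurable
      have E_le: "measure \<mu> (E M) \<le> (2 * real m * A * sqrt (real m + 2) / \<epsilon>\<^sup>2) * (1 / (real M + 1)\<^sup>2)" for M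
      proof -
        define N where "N = Suc M ^ 4"
        \<comment> \<open>N + m digits show every block of length m that follows one of the
          positions up to N.\<close>
        define L where "L = N + m"
        have "N > 0" by (simp add: N_def)
        define B where "B = {a. a < b ^ L \<and> \<epsilon> * real N \<le> \<bar>\<Sum>k=1..N. digit_dev b m u L k a\<bar>}"
        have "finite B" unfolding B_def by simp
        have sets_cell: "{x. \<lfloor>real b ^ L * x\<rfloor> = int a} \<in> sets \<mu>" for a
          unfolding sets_eq by measurable
        have sub: "x \<in> (\<Union>a\<in>B. {x. \<lfloor>real b ^ L * x\<rfloor> = int a})" if "x \<in> E M" "0 \<le> x" "x < 1" for x
        proof -
          let ?a = "nat \<lfloor>real b ^ L * x\<rfloor>"
          have "real b ^ L * x < real b ^ L * 1"
            using \<open>b > 0\<close> that by (intro mult_strict_left_mono) auto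
          then have "\<lfloor>real b ^ L * x\<rfloor> < int (b ^ L)"
            by (simp add: floor_less_iff)
          then have "int ?a < int (b ^ L)"
            using that by (subst int_nat_eq) simp
          then have "?a < b ^ L"
            by (simp only: of_nat_less_iff)
          moreover have "\<epsilon> * real N \<le> \<bar>\<Sum>k=1..N. digit_dev b m u L k ?a\<bar>"
            using that(1) unfolding E_def D_def N_def[symmetric]
            by (subst sum_digit_dev_eq_count) (use \<open>b > 0\<close> that in \<open>auto simp: L_def\<close>)
          ultimately have "?a \<in> B" by (simp add: B_def)
          moreover have "\<lfloor>real b ^ L * x\<rfloor> = int ?a" using that by simp
          ultimately show ?thesis by blast
        qed
        have "measure \<mu> (E M) \<le> measure \<mu> (\<Union>a\<in>B. {x. \<lfloor>real b ^ L * x\<rfloor> = int a})"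
        proof (rule finite_measure_mono_AE)
          show "AE x in \<mu>. x \<in> E M \<longrightarrow> x \<in> (\<Union>a\<in>B. {x. \<lfloor>real b ^ L * x\<rfloor> = int a})"
            using AE by eventually_elim (use sub in blast)
        qed (intro sets.finite_UN \<open>finite B\<close> sets_cell)
        also have "\<dots> \<le> (\<Sum>a\<in>B. measure \<mu> {x. \<lfloor>real b ^ L * x\<rfloor> = int a})"
          by (rule measure_UNION_le[OF \<open>finite B\<close> sets_cell])
        also have "\<dots> \<le> real (card B) * (A * sqrt (real L + 1) / real (b ^ L))"
          by (rule sum_bounded_above[OF cell])
        also have "\<dots> \<le> (real (b ^ L) * (2 * real m / (\<epsilon>\<^sup>2 * real N))) * (A * sqrt (real L + 1) / real (b ^ L))"
          unfolding B_def using True \<open>b > 0\<close> \<open>\<epsilon> > 0\<close> \<open>N > 0\<close> \<open>0 \<le> A\<close>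
          by (intro mult_right_mono card_large_digit_dev) (auto simp: L_def)
        also have "\<dots> = (2 * real m * A / (\<epsilon>\<^sup>2 * real N)) * sqrt (real L + 1)"
          using \<open>b > 0\<close> by simp
        also have "\<dots> \<le> (2 * real m * A / (\<epsilon>\<^sup>2 * real N)) * (sqrt (real m + 2) * (real M + 1)\<^sup>2)"
        proof (rule mult_left_mono)
          have "1 \<le> real N" using \<open>N > 0\<close> by simp
          \<comment> \<open>The summand m + 1 is absorbed because N is at least 1; as N is a fourth
            power, its square root is (M + 1)^2.\<close>
          then have "real L + 1 \<le> (real m + 2) * real N"
            using mult_left_mono[of 1 "real N" "real m + 1"] by (simp add: L_def algebra_simps)
          then have "sqrt (real L + 1) \<le> sqrt ((real m + 2) * real N)"
            by (rule real_sqrt_le_mono)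
          also have "real N = ((real M + 1)\<^sup>2)\<^sup>2"
            by (simp add: N_def power_mult[symmetric] add.commute)
          then have "sqrt ((real m + 2) * real N) = sqrt (real m + 2) * (real M + 1)\<^sup>2"
            by (simp only: real_sqrt_mult real_sqrt_abs abs_power2)
          finally show "sqrt (real L + 1) \<le> sqrt (real m + 2) * (real M + 1)\<^sup>2" .
        qed (use \<open>0 \<le> A\<close> in auto)
        also have "real N = (real M + 1)\<^sup>2 * (real M + 1)\<^sup>2"
          by (simp add: N_def power_add[symmetric] add.commute)
        also have "(2 * real m * A / (\<epsilon>\<^sup>2 * ((real M + 1)\<^sup>2 * (real M + 1)\<^sup>2))) * (sqrt (real m + 2) * (real M + 1)\<^sup>2)
            = (2 * real m * A * sqrt (real m + 2) / \<epsilon>\<^sup>2) * (1 / (real M + 1)\<^sup>2)"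
        proof -
          have *: "c / (\<epsilon>\<^sup>2 * (z * z)) * (s * z) = (c * s / \<epsilon>\<^sup>2) * (1 / z)" if "z > 0" for c s z :: real
            using \<open>\<epsilon> > 0\<close> that by simp
          show ?thesis by (rule *) simp
        qed
        finally show ?thesis .
      qed
      have "summable (\<lambda>M. (2 * real m * A * sqrt (real m + 2) / \<epsilon>\<^sup>2) * (1 / (real M + 1)\<^sup>2))"
        using sums_summable[OF inverse_squares_sums] by (intro summable_mult) (simp add: add.commute)
      then have "summable (\<lambda>M. measure \<mu> (E M))"
        by (rule summable_comparison_test'[of _ 0]) (use E_le in simp)
      then have "AE x in \<mu>. \<forall>\<^sub>F M in sequentially. x \<in> space \<mu> - E M"
        by (intro borel_cantelli_AE1 E_sets) (simp_all add: emeasure_eq_measure)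
      then show ?thesis
      proof eventually_elim
        case (elim x)
        then have "\<forall>\<^sub>F M in sequentially. D m u (Suc M ^ 4) x < real (Suc M ^ 4) / real (Suc i)"
          by eventually_elim (simp add: E_def \<epsilon>_def not_le)
        then show ?case by blast
      qed
    qed auto
  qed
  then show ?thesis
  proof eventually_elim
    case (elim x)
    show ?case
      unfolding normal_in_base_def
    proof (rule equidistributed_if_adic_frequencies[OF \<open>b \<ge> 2\<close> tendsto_ratio_interpolate])
      fix m u :: nat
      assume mu: "1 \<le> m" "u \<le> b ^ m"
      let ?t = "real u / real (b ^ m)"
      let ?c = "count_below (\<lambda>k. frac (real b ^ k * x)) ?t"
      show "mono ?c"
        by (intro monoI count_below_mono) auto
      have "(\<lambda>M. real (?c (Suc M ^ 4)) / real (Suc M ^ 4)) \<longlonglongrightarrow> ?t"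
      proof (rule LIMSEQ_I)
        fix r :: real assume "r > 0"
        then obtain i where i: "1 / real (Suc i) < r"
          using nat_approx_posE by blast
        have "\<forall>\<^sub>F M in sequentially. D m u (Suc M ^ 4) x < real (Suc M ^ 4) / real (Suc i)"
          using elim mu by blast
        then have "\<forall>\<^sub>F M in sequentially. norm (real (?c (Suc M ^ 4)) / real (Suc M ^ 4) - ?t) < r"
        proof eventually_elim
          case (elim M)
          define N where "N = Suc M ^ 4"
          have N: "real N > 0" by (simp add: N_def)
          have "real (?c N) / real N - ?t = (real (?c N) - real N * ?t) / real N"
            using N by (simp add: field_simps)
          then have "norm (real (?c N) / real N - ?t) = D m u N x / real N"
            using N by (simp only: D_def real_norm_def abs_divide abs_of_pos)
          also have "\<dots> < 1 / real (Suc i)"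
            using elim N unfolding N_def[symmetric] by (simp add: pos_divide_less_eq field_simps)
          finally show ?case
            using i unfolding N_def by linarith
        qed
        then show "\<exists>no. \<forall>M\<ge>no. norm (real (?c (Suc M ^ 4)) / real (Suc M ^ 4) - ?t) < r"
          unfolding eventually_sequentially .
      qed
      then show "(\<lambda>M. real (?c (M ^ 4)) / real (M ^ 4)) \<longlonglongrightarrow> ?t"
        by (rule LIMSEQ_imp_Suc)
    qed
  qed
qed

section \<open>Hausdorff measure\<close>

text \<open>The element \<open>s j\<close> is at least \<open>g (Suc j)\<close>, and a count of
  \<open>Suc j\<close> below n forces \<open>s j < n\<close>, so the count reaches a value only
  after g has been passed there. The summand 1 makes s strictly increasing.\<close>

lemma infinite_sparse_set:
  fixes g :: "nat \<Rightarrow> nat"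
  obtains S where "infinite S" "\<And>n. card (S \<inter> {..<n}) > 0 \<Longrightarrow> g (card (S \<inter> {..<n})) \<le> n"
proof -
  define s where "s j = (\<Sum>i\<le>j. g (Suc i) + 1)" for j
  have "strict_mono s"
    by (rule strict_monoI_Suc) (simp add: s_def)
  then have "infinite (range s)"
    by (simp add: strict_mono_imp_inj_on range_inj_infinite)
  moreover have "g (card (range s \<inter> {..<n})) \<le> n" if "card (range s \<inter> {..<n}) > 0" for n
  proof -
    obtain j where j: "card (range s \<inter> {..<n}) = Suc j"
      using \<open>card (range s \<inter> {..<n}) > 0\<close> gr0_conv_Suc by auto
    have "s j < n"
    proof (rule ccontr)
      assume "\<not> s j < n"
      have "range s \<inter> {..<n} \<subseteq> s ` {..<j}"
      proof
        fix y assume "y \<in> range s \<inter> {..<n}"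
        then obtain i where i: "y = s i" "s i < n" by auto
        then have "s i < s j" using \<open>\<not> s j < n\<close> by simp
        then have "i < j" using strict_mono_less[OF \<open>strict_mono s\<close>] by blast
        then show "y \<in> s ` {..<j}" using i by auto
      qed
      then have "card (range s \<inter> {..<n}) \<le> card (s ` {..<j})"
        by (intro card_mono) auto
      also have "\<dots> \<le> j"
        using card_image_le[of "{..<j}" s] by simp
      finally show False using j by simp
    qed
    moreover have "g (Suc j) \<le> s j"
      unfolding s_def using member_le_sum[of j "{..j}" "\<lambda>i. g (Suc i) + 1"] by simp
    ultimately show ?thesis using j by simp
  qed
  ultimately show ?thesis using that by blast
qed

text \<open>Each covering set is enlarged to the interval that starts at its infimum and has the
  same diameter. These hulls are measurable and together carry full mass, so bounds for intervals
  control the sum over any cover.\<close>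

lemma mass_distribution_principle:
  fixes \<mu> :: "real measure"
  assumes "prob_space \<mu>" and sets_eq: "sets \<mu> = sets borel" and AE: "AE x in \<mu>. x \<in> E"
    and "\<delta> > 0" and bound: "\<And>x y. x \<le> y \<Longrightarrow> y - x \<le> \<delta> \<Longrightarrow> measure \<mu> {x..y} \<le> \<phi> (y - x)"
  shows "hausdorff_measure \<phi> E > 0"
proof -
  interpret prob_space \<mu> by fact
  have "1 \<le> hausdorff_premeasure \<phi> \<delta> E"
    unfolding hausdorff_premeasure_def
  proof (rule INF_greatest)
    fix U :: "nat \<Rightarrow> real set"
    assume "U \<in> {U. E \<subseteq> (\<Union>i. U i) \<and> (\<forall>i. bounded (U i) \<and> diameter (U i) \<le> \<delta>)}"
    then have U: "E \<subseteq> (\<Union>i. U i)" "\<And>i. bounded (U i)" "\<And>i. diameter (U i) \<le> \<delta>" by auto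
    \<comment> \<open>The empty set is treated apart because its infimum carries no
      information.\<close>
    define V where "V i = (if U i = {} then {} else {Inf (U i)..Inf (U i) + diameter (U i)})" for i
    have V_sets: "V i \<in> sets \<mu>" for i
      by (simp add: V_def sets_eq)
    have UV: "U i \<subseteq> V i" for i
    proof
      fix x assume x: "x \<in> U i"
      have "Inf (U i) \<le> x"
        using x bounded_imp_bdd_below[OF U(2)] by (rule cInf_lower)
      moreover have "x - diameter (U i) \<le> Inf (U i)"
      proof (rule cInf_greatest)
        fix y assume "y \<in> U i"
        then have "dist x y \<le> diameter (U i)"
          using x U(2) by (intro diameter_bounded_bound)
        then show "x - diameter (U i) \<le> y" by (simp add: dist_real_def)
      qed (use x in auto)
      ultimately show "x \<in> V i" using x by (auto simp: V_def)
    qed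
    have "AE x in \<mu>. x \<in> (\<Union>i. V i)"
      using AE by eventually_elim (use U(1) UV in blast)
    then have "emeasure \<mu> (\<Union>i. V i) = 1"
      using V_sets by (intro emeasure_eq_1_AE sets.countable_UN) auto
    then have "1 \<le> (\<Sum>i. emeasure \<mu> (V i))"
      using emeasure_subadditive_countably[of V \<mu>] V_sets by auto
    also have "\<dots> \<le> (\<Sum>i. ennreal (\<phi> (diameter (U i))))"
    proof (intro suminf_le summableI)
      fix i
      show "emeasure \<mu> (V i) \<le> ennreal (\<phi> (diameter (U i)))"
      proof (cases "U i = {}")
        case False
        then have "measure \<mu> (V i) \<le> \<phi> (diameter (U i))"
          using bound[of "Inf (U i)" "Inf (U i) + diameter (U i)"] U(3)[of i] diameter_ge_0[OF U(2)[of i]]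
          by (simp add: V_def)
        then show ?thesis
          by (simp add: emeasure_eq_measure ennreal_leI)
      qed (simp add: V_def)
    qed
    finally show "1 \<le> (\<Sum>i. ennreal (\<phi> (diameter (U i))))" .
  qed
  also have "\<dots> \<le> hausdorff_measure \<phi> E"
    unfolding hausdorff_measure_eq_SUP using \<open>\<delta> > 0\<close> by (intro SUP_upper) simp
  finally show ?thesis
    by (rule less_le_trans[rotated]) simp
qed

section \<open>Comparing masses with the gauge and with base b cells\<close>

lemma dyadic_scale:
  fixes r :: real
  assumes "0 < r" "r \<le> 1"
  obtains n where "1 / 2 ^ Suc n < r" "r \<le> 1 / 2 ^ n"
proof -
  define P where "P n \<longleftrightarrow> 1 / 2 ^ n < r" for n :: nat
  have "\<exists>n. (1 / 2) ^ n < r"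
    using assms by (intro real_arch_pow_inv) auto
  then have "\<exists>n. P n" by (simp add: P_def power_divide)
  moreover have "\<not> P 0" using assms by (simp add: P_def)
  ultimately obtain n where "\<not> P n" "P (Suc n)"
    using exists_least_lemma[of P] by blast
  then show ?thesis using that[of n] by (auto simp: P_def)
qed

lemma gauge_dominates_linear:
  fixes \<phi> :: "real \<Rightarrow> real"
  assumes gauge: "gauge_function \<phi>"
    and nonzero: "\<forall>\<^sub>F r in at_right 0. \<phi> r \<noteq> 0"
    and growth: "\<exists>c>0. ((\<lambda>r. r * exp (c * (ln (1 / r) / ln (ln (1 / r))) powr (1 / 4)) / \<phi> r)
                   \<longlongrightarrow> 0) (at_right 0)"
    and "B > 0"
  shows "\<forall>\<^sub>F r in at_right 0. B * r \<le> \<phi> r"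
proof -
  obtain c where "c > 0" and lim: "((\<lambda>r. r * exp (c * (ln (1 / r) / ln (ln (1 / r))) powr (1 / 4)) / \<phi> r)
                   \<longlongrightarrow> 0) (at_right 0)"
    using growth by blast
  have "\<forall>\<^sub>F r in at_right 0. r * exp (c * (ln (1 / r) / ln (ln (1 / r))) powr (1 / 4)) / \<phi> r < 1 / B"
    using lim by (rule order_tendstoD) (use \<open>B > 0\<close> in simp)
  moreover have "\<forall>\<^sub>F r in at_right 0. r > (0::real)"
    by (simp add: eventually_at_right_less)
  ultimately show ?thesis
    using nonzero
  proof eventually_elim
    fix r :: real
    let ?H = "exp (c * (ln (1 / r) / ln (ln (1 / r))) powr (1 / 4))"
    assume r: "r * ?H / \<phi> r < 1 / B" "r > 0" "\<phi> r \<noteq> 0"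
    \<comment> \<open>Where \<open>\<phi> r\<close> vanishes the quotient would be 0 by convention
      and the limit would say nothing; \<open>nonzero\<close> excludes this.\<close>
    have "\<phi> r > 0"
      using gauge r unfolding gauge_function_def by (auto simp: less_le)
    have "1 \<le> ?H"
      using \<open>c > 0\<close> by simp
    then have "r * 1 / \<phi> r \<le> r * ?H / \<phi> r"
      using r \<open>\<phi> r > 0\<close> by (intro divide_right_mono mult_left_mono) auto
    then have "r / \<phi> r < 1 / B" using r by simp
    then show "B * r \<le> \<phi> r"
      using \<open>\<phi> r > 0\<close> \<open>B > 0\<close> by (simp add: field_simps)
  qed
qed

text \<open>The length r is compared with the dyadic scale just above it. The factor 4 is 2 for the
  two cells met by the interval times 2 for rounding to a power of 2.\<close>

lemma measure_Icc_le_gauge: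
  fixes \<mu> :: "real measure" and \<phi> :: "real \<Rightarrow> real"
  assumes Icc: "\<And>n x y. y - x \<le> 1 / 2 ^ n \<Longrightarrow> measure \<mu> {x..y} \<le> 2 * (2 ^ k n / 2 ^ n)"
    and "\<phi> 0 = 0" and k: "mono k" "k n0 > 0" "\<And>n. (4::nat) ^ k n \<le> n + 1"
    and \<phi>: "\<And>n r. k n > 0 \<Longrightarrow> 0 < r \<Longrightarrow> r \<le> 1 / 2 ^ n \<Longrightarrow> 4 * 2 ^ k n * r \<le> \<phi> r"
    and xy: "x \<le> y" "y - x \<le> 1 / 2 ^ n0"
  shows "measure \<mu> {x..y} \<le> \<phi> (y - x)"
proof (cases "x = y")
  case True
  \<comment> \<open>At length 0 the gauge vanishes, so a single point must have mass 0: the bounds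
    at all scales n apply to it and tend to 0.\<close>
  have "measure \<mu> {x..y} \<le> 2 * ((real n + 1) / 2 ^ n)" for n
  proof -
    have "measure \<mu> {x..y} \<le> 2 * (2 ^ k n / 2 ^ n)"
      using Icc[of y x n] True by simp
    also have "(2::nat) ^ k n \<le> 4 ^ k n"
      by (intro power_mono) auto
    then have "(2::nat) ^ k n \<le> n + 1"
      using k(3)[of n] by linarith
    then have "real (2 ^ k n) \<le> real (n + 1)"
      by (simp only: of_nat_le_iff)
    then have "2 * (2 ^ k n / 2 ^ n) \<le> 2 * ((real n + 1) / 2 ^ n)"
      by (intro mult_left_mono divide_right_mono) auto
    finally show ?thesis .
  qed
  moreover have "(\<lambda>n. 2 * ((real n + 1) / 2 ^ n)) \<longlonglongrightarrow> 0"
    by real_asymp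
  ultimately have "measure \<mu> {x..y} \<le> 0"
    by (intro LIMSEQ_le_const) auto
  then show ?thesis using True \<open>\<phi> 0 = 0\<close> by simp
next
  case False
  define r where "r = y - x"
  have r: "0 < r" "r \<le> 1 / 2 ^ n0"
    using xy False by (auto simp: r_def)
  moreover have "1 / 2 ^ n0 \<le> (1::real)" by simp
  ultimately obtain n where n: "1 / 2 ^ Suc n < r" "r \<le> 1 / 2 ^ n"
    using dyadic_scale[of r] by (metis order_trans)
  have "(1::real) / 2 ^ Suc n < 1 / 2 ^ n0"
    using n(1) r(2) by linarith
  then have "(2::real) ^ n0 < 2 ^ Suc n"
    by (simp add: divide_less_eq less_divide_eq)
  then have "n0 \<le> n"
    using power_less_imp_less_exp[of "2::real" n0 "Suc n"] by simp
  then have "k n > 0"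
    using monoD[OF k(1)] k(2) by (metis less_le_trans)
  have "measure \<mu> {x..y} \<le> 2 * (2 ^ k n / 2 ^ n)"
    using Icc n(2) by (simp add: r_def)
  also have "\<dots> = 4 * 2 ^ k n * (1 / 2 ^ Suc n)"
    by simp
  also have "\<dots> \<le> 4 * 2 ^ k n * r"
    using n(1) by (intro mult_left_mono) auto
  also have "\<dots> \<le> \<phi> r"
    using \<open>k n > 0\<close> r(1) n(2) by (rule \<phi>)
  finally show ?thesis by (simp add: r_def)
qed

text \<open>A base b cell is treated as an interval of length \<open>1 / b ^ L\<close>, estimated at
  the dyadic scale n just above it. As \<open>b < 2 ^ b\<close>, this n is at most
  \<open>b * L\<close>, so the factor \<open>2 ^ k n\<close>, being at most sqrt (n + 1), costs no
  more than sqrt (b (L + 1)).\<close>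

lemma measure_adic_cell_le:
  fixes \<mu> :: "real measure"
  assumes "prob_space \<mu>" and sets_eq: "sets \<mu> = sets borel"
    and Icc: "\<And>n x y. y - x \<le> 1 / 2 ^ n \<Longrightarrow> measure \<mu> {x..y} \<le> 2 * (2 ^ k n / 2 ^ n)"
    and k: "\<And>n. (4::nat) ^ k n \<le> n + 1" and "b > 0"
  shows "measure \<mu> {x. \<lfloor>real b ^ L * x\<rfloor> = int a} \<le> (4 * sqrt (real b)) * sqrt (real L + 1) / real (b ^ L)"
proof -
  interpret prob_space \<mu> by fact
  define B where "B = real b ^ L"
  have "B \<ge> 1" using \<open>b > 0\<close> by (simp add: B_def)
  then obtain n where n: "1 / 2 ^ Suc n < 1 / B" "1 / B \<le> 1 / 2 ^ n"
    using dyadic_scale[of "1 / B"] by auto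
  have "2 ^ n \<le> B"
    using n(2) \<open>B \<ge> 1\<close> by (simp add: field_simps)
  also have "real b < 2 ^ b"
    by (rule of_nat_less_two_power)
  then have "B \<le> (2 ^ b) ^ L"
    unfolding B_def by (intro power_mono) auto
  finally have "n \<le> b * L"
    by (simp add: power_mult[symmetric])
  have "(2 ^ k n)\<^sup>2 = real (4 ^ k n)"
    by (simp add: power_mult[symmetric] mult.commute[of _ 2]) (simp add: power_mult)
  also have "\<dots> \<le> real (n + 1)"
    by (simp only: of_nat_le_iff k)
  also have "\<dots> \<le> real b * (real L + 1)"
  proof -
    have "n + 1 \<le> b * (L + 1)" using \<open>n \<le> b * L\<close> \<open>b > 0\<close> by simp
    then have "real (n + 1) \<le> real (b * (L + 1))" by (simp only: of_nat_le_iff)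
    then show ?thesis by (simp add: algebra_simps)
  qed
  finally have "2 ^ k n \<le> sqrt (real b * (real L + 1))"
    by (rule real_le_rsqrt)
  then have k_le: "2 ^ k n \<le> sqrt (real b) * sqrt (real L + 1)"
    by (simp add: real_sqrt_mult)
  have "{x. \<lfloor>real b ^ L * x\<rfloor> = int a} \<subseteq> {real a / B..(real a + 1) / B}"
  proof
    fix x assume "x \<in> {x. \<lfloor>real b ^ L * x\<rfloor> = int a}"
    then have "real a \<le> B * x" "B * x \<le> real a + 1"
      unfolding B_def mem_Collect_eq by linarith+
    then show "x \<in> {real a / B..(real a + 1) / B}"
      using \<open>B \<ge> 1\<close> by (simp add: field_simps)
  qed
  then have "measure \<mu> {x. \<lfloor>real b ^ L * x\<rfloor> = int a} \<le> measure \<mu> {real a / B..(real a + 1) / B}"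
    by (rule finite_measure_mono) (simp add: sets_eq)
  also have "\<dots> \<le> 2 * (2 ^ k n / 2 ^ n)"
    using n(2) by (intro Icc) (simp add: diff_divide_distrib[symmetric])
  also have "\<dots> = 4 * 2 ^ k n * (1 / 2 ^ Suc n)"
    by simp
  also have "\<dots> \<le> 4 * 2 ^ k n * (1 / B)"
    using n(1) by (intro mult_left_mono) auto
  also have "\<dots> \<le> 4 * (sqrt (real b) * sqrt (real L + 1)) * (1 / B)"
    using k_le \<open>B \<ge> 1\<close> by (intro mult_right_mono mult_left_mono) auto
  finally show ?thesis by (simp add: B_def)
qed

theorem theorem6p8:
  fixes \<phi> :: "real \<Rightarrow> real"
  assumes gauge: "gauge_function \<phi>"
    and nonzero: "\<forall>\<^sub>F r in at_right 0. \<phi> r \<noteq> 0"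
    and growth: "\<exists>c>0. ((\<lambda>r. r * exp (c * (ln (1 / r) / ln (ln (1 / r))) powr (1 / 4)) / \<phi> r)
                   \<longlongrightarrow> 0) (at_right 0)"
  shows "\<exists>K \<subseteq> {0..1}. compact K \<and> set_of_uniqueness K \<and>
           hausdorff_measure \<phi> K > 0 \<and> hausdorff_measure \<phi> (K \<inter> absolutely_normal) > 0"
proof -
  \<comment> \<open>From level \<open>i\<close> on the gauge pays for j erased digits, with the
    factor 4 of the interval estimate.\<close>
  have "\<exists>i::nat. \<forall>r. 0 < r \<and> r \<le> 1 / 2 ^ i \<longrightarrow> 4 * 2 ^ j * r \<le> \<phi> r" for j :: nat
  proof -
    obtain d where d: "d > 0" "\<And>r. 0 < r \<Longrightarrow> r < d \<Longrightarrow> 4 * 2 ^ j * r \<le> \<phi> r"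
      using gauge_dominates_linear[OF gauge nonzero growth, of "4 * 2 ^ j"]
      unfolding eventually_at_right_field by auto
    obtain i where "(1 / 2) ^ i < d"
      using real_arch_pow_inv[OF \<open>d > 0\<close>, of "1 / 2"] by auto
    then have "1 / 2 ^ i < d" by (simp add: power_divide)
    then have "\<forall>r. 0 < r \<and> r \<le> 1 / 2 ^ i \<longrightarrow> 4 * 2 ^ j * r \<le> \<phi> r"
      using d(2) by fastforce
    then show ?thesis by blast
  qed
  then obtain i :: "nat \<Rightarrow> nat" where i: "\<And>j r. 0 < r \<Longrightarrow> r \<le> 1 / 2 ^ i j \<Longrightarrow> 4 * 2 ^ j * r \<le> \<phi> r"
    by metis
  \<comment> \<open>The bound \<open>4 ^ j\<close> keeps the loss of mass at a square root, for
    normality; \<open>i j\<close> serves the gauge.\<close>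
  obtain S where S: "infinite S"
    "\<And>n. card (S \<inter> {..<n}) > 0 \<Longrightarrow> max (4 ^ card (S \<inter> {..<n})) (i (card (S \<inter> {..<n}))) \<le> n"
    using infinite_sparse_set[of "\<lambda>j. max (4 ^ j) (i j)"] by blast
  define k where "k n = card (S \<inter> {..<n})" for n
  have "mono k"
    unfolding k_def by (intro monoI card_mono) auto
  obtain s0 where "s0 \<in> S"
    using S(1) by (metis finite.emptyI ex_in_conv)
  define n0 where "n0 = Suc s0"
  have "s0 \<in> S \<inter> {..<n0}"
    using \<open>s0 \<in> S\<close> by (simp add: n0_def)
  then have "k n0 > 0"
    unfolding k_def by (subst card_gt_0_iff) auto
  \<comment> \<open>While no digit is erased the left side is 1, and at n = 0 this needs the summand
    1.\<close>
  have k4: "4 ^ k n \<le> n + 1" for n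
    using S(2)[of n] unfolding k_def[symmetric] by (cases "k n = 0") auto
  have k\<phi>: "4 * 2 ^ k n * r \<le> \<phi> r" if "k n > 0" "0 < r" "r \<le> 1 / 2 ^ n" for n r
  proof (rule i[OF that(2)])
    have "i (k n) \<le> n"
      using S(2)[of n] that(1) unfolding k_def[symmetric] by simp
    then have "(1::real) / 2 ^ n \<le> 1 / 2 ^ i (k n)"
      by (intro divide_left_mono power_increasing) auto
    then show "r \<le> 1 / 2 ^ i (k n)" using that(3) by linarith
  qed

  obtain \<mu> :: "real measure" where \<mu>: "prob_space \<mu>" "sets \<mu> = sets borel"
    and unit: "AE x in \<mu>. 0 \<le> x \<and> x < 1"
    and sin: "AE x in \<mu>. \<forall>s\<in>S. 0 \<le> sin (2 * pi * 2 ^ s * x)"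
    and cell: "\<And>n j. measure \<mu> {x. \<lfloor>2 ^ n * x\<rfloor> = int j} \<le> 2 ^ card (S \<inter> {..<n}) / 2 ^ n"
    using masked_digit_measure[OF S(1)] by blast
  have Icc: "measure \<mu> {x..y} \<le> 2 * (2 ^ k n / 2 ^ n)" if "y - x \<le> 1 / 2 ^ n" for n x y
    using measure_Icc_le_two_cells[OF \<mu> unit cell that] by (simp add: k_def)
  have "\<phi> 0 = 0"
    using gauge by (simp add: gauge_function_def)
  have positive: "hausdorff_measure \<phi> E > 0" if "AE x in \<mu>. x \<in> E" for E
  proof (rule mass_distribution_principle[OF \<mu> that])
    show "(0::real) < 1 / 2 ^ n0" by simp
    show "measure \<mu> {x..y} \<le> \<phi> (y - x)" if "x \<le> y" "y - x \<le> 1 / 2 ^ n0" for x y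
      by (rule measure_Icc_le_gauge[OF Icc \<open>\<phi> 0 = 0\<close> \<open>mono k\<close> \<open>k n0 > 0\<close> k4 k\<phi> that])
  qed

  \<comment> \<open>Being cut out by closed conditions on the sine, rather than taken as the image
    of the masked points, K is visibly compact.\<close>
  define K where "K = {0..1} \<inter> (\<Inter>s\<in>S. {x. 0 \<le> sin (2 * pi * 2 ^ s * x)})"
  have "compact K"
    unfolding K_def
    by (intro compact_Int_closed compact_Icc closed_INT ballI closed_Collect_le continuous_intros)
  moreover have "set_of_uniqueness K"
  proof (rule H_set_imp_set_of_uniqueness)
    show "K \<subseteq> {0..1}" by (simp add: K_def)
    have "infinite ((\<lambda>s. 2 ^ s :: nat) ` S)"
      using S(1) by (subst finite_image_iff) (auto intro!: inj_onI)
    moreover have "(\<lambda>s. 2 ^ s) ` S \<subseteq> {n. \<forall>x\<in>K. 0 \<le> sin (2 * pi * real n * x)}"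
      by (auto simp: K_def)
    ultimately show "infinite {n. \<forall>x\<in>K. 0 \<le> sin (2 * pi * real n * x)}"
      using finite_subset by blast
  qed
  moreover have AE_K: "AE x in \<mu>. x \<in> K"
    using unit sin by eventually_elim (auto simp: K_def)
  then have "hausdorff_measure \<phi> K > 0"
    by (rule positive)
  moreover have "AE x in \<mu>. x \<in> absolutely_normal"
    unfolding absolutely_normal_def mem_Collect_eq AE_all_countable
  proof
    fix b :: nat
    show "AE x in \<mu>. 2 \<le> b \<longrightarrow> normal_in_base b x"
    proof (cases "2 \<le> b")
      case True
      then have "AE x in \<mu>. normal_in_base b x"
        using measure_adic_cell_le[OF \<mu> Icc k4]
        by (intro AE_normal_in_base[OF \<mu> unit, where A = "4 * sqrt (real b)"]) auto
      then show ?thesis by eventually_elim simp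
    qed simp
  qed
  then have "AE x in \<mu>. x \<in> K \<inter> absolutely_normal"
    using AE_K by eventually_elim simp
  then have "hausdorff_measure \<phi> (K \<inter> absolutely_normal) > 0"
    by (rule positive)
  ultimately show ?thesis
    by (intro exI[of _ K]) (auto simp: K_def)
qed

end
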